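(* Let $w>0$ and let $P$ be an ordinary reduced polygon in $H^2$ of minimal width $w$. Then its circumradius is at most $$ \operatorname{arsinh}\left(\frac{2}{\sqrt{3}}\sqrt{\left(\frac{\cosh w+\sqrt{\cosh^2 w+8}}{4}\right)^2-1}\right), $$ with equality if and only if $P$ is a regular triangle.
   Context: $H^2$ is the hyperbolic plane (constant curvature $-1$) with geodesic distance $d$. A set is convex if it contains the geodesic segment joining any two of its points; a convex body is a compact convex set with non-empty interior; a polygon is a convex body that is the convex hull of finitely many points, and a $k$-gon is a polygon with $k$ vertices (a vertex is a point of the generating set not in the convex hull of the others). The circumradius of $P$ is the radius of the smallest closed circular disk containing $P$. Width: a line $\ell$ is a supporting line of a convex body $K$ if $K\cap\ell\neq\emptyset$ and $K$ lies in one of the closed half-planes bounded by $\ell$. The width of $K$ with respect to a supporting line $\ell$ is the distance between $\ell$ and a most distant supporting line $\ell'$ of $K$ from $\ell$. The minimal width (thickness) $w(K)$ is the minimum of the width over all supporting lines. Ordinary reduced polygon: let $n\ge 3$ be odd and let $P$ be a convex $n$-gon in $H^2$ with vertices $v_1,\dots,v_n$ in positively oriented cyclic order (indices mod $n$). The side opposite to $v_i$ is $[v_{i+\frac{n-1}{2}},v_{i+\frac{n+1}{2}}]$. $P$ of minimal width $w$ is called an ordinary reduced polygon if for every $i$ the distance of $v_i$ from its opposite side is $w$ and the orthogonal projection of $v_i$ onto the line of the opposite side lies in the relative interior of that side. *)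

theory Defs
  imports "HOL-Analysis.Analysis"
begin

section \<open>The hyperbolic plane: hyperboloid model\<close>

definition mink :: "real^3 \<Rightarrow> real^3 \<Rightarrow> real" where
  "mink x y = x$1 * y$1 + x$2 * y$2 - x$3 * y$3"

typedef hyp_plane = "{x :: real^3. mink x x = -1 \<and> x$3 > 0}"
  morphisms hvec Abs_hyp
proof
  show "vector [0, 0, 1] \<in> {x :: real^3. mink x x = -1 \<and> x$3 > 0}"
    by (simp add: mink_def)
qed

lemma mink_commute: "mink x y = mink y x"
  by (simp add: mink_def)

lemma mink_hvec_self: "mink (hvec x) (hvec x) = -1"
  and hvec_3_pos: "hvec x $ 3 > 0"
  using hvec[of x] by auto

lemma mink_identity:
  assumes "mink x x = -1" "mink y y = -1"
  shows "(x$3 * y$3)\<^sup>2 = (1 + (x$1 * y$1 + x$2 * y$2))\<^sup>2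
    + ((x$1 - y$1)\<^sup>2 + (x$2 - y$2)\<^sup>2 + (x$1 * y$2 - x$2 * y$1)\<^sup>2)"
proof -
  have x: "x$3 * x$3 = 1 + x$1 * x$1 + x$2 * x$2" and y: "y$3 * y$3 = 1 + y$1 * y$1 + y$2 * y$2"
    using assms by (auto simp: mink_def)
  have "(x$3 * y$3)\<^sup>2 = (x$3 * x$3) * (y$3 * y$3)"
    by (simp add: power2_eq_square)
  also have "\<dots> = (1 + x$1 * x$1 + x$2 * x$2) * (1 + y$1 * y$1 + y$2 * y$2)"
    by (simp add: x y)
  finally show ?thesis
    by (simp add: power2_eq_square algebra_simps)
qed

lemma mink_hvec_ge_1: "- mink (hvec x) (hvec y) \<ge> 1"
proof -
  let ?x = "hvec x" and ?y = "hvec y"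
  have "(1 + (?x$1 * ?y$1 + ?x$2 * ?y$2))\<^sup>2 \<le> (?x$3 * ?y$3)\<^sup>2"
    by (subst mink_identity) (auto simp: mink_hvec_self)
  moreover have "0 \<le> ?x$3 * ?y$3"
    using hvec_3_pos[of x] hvec_3_pos[of y] by simp
  ultimately have "1 + (?x$1 * ?y$1 + ?x$2 * ?y$2) \<le> ?x$3 * ?y$3"
    by (rule power2_le_imp_le)
  then show ?thesis by (simp add: mink_def)
qed

lemma mink_hvec_eq_1_iff: "- mink (hvec x) (hvec y) = 1 \<longleftrightarrow> x = y"
proof
  let ?x = "hvec x" and ?y = "hvec y"
  assume "- mink ?x ?y = 1"
  then have "?x$3 * ?y$3 = 1 + (?x$1 * ?y$1 + ?x$2 * ?y$2)"
    by (simp add: mink_def)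
  with mink_identity[OF mink_hvec_self mink_hvec_self, of x y]
  have "(?x$1 - ?y$1)\<^sup>2 + (?x$2 - ?y$2)\<^sup>2 + (?x$1 * ?y$2 - ?x$2 * ?y$1)\<^sup>2 = 0"
    by simp
  then have "?x$1 - ?y$1 = 0" "?x$2 - ?y$2 = 0"
    by (smt (verit) zero_le_power2 power2_eq_iff_nonneg power_zero_numeral zero_eq_power2)+
  then have 12: "?x$1 = ?y$1" "?x$2 = ?y$2" by auto
  then have "(?x$3)\<^sup>2 = (?y$3)\<^sup>2"
    using mink_hvec_self[of x] mink_hvec_self[of y] by (simp add: mink_def power2_eq_square)
  then have "?x$3 = ?y$3"
    using hvec_3_pos[of x] hvec_3_pos[of y] by (simp add: power2_eq_iff_nonneg)
  with 12 have "?x = ?y" by (simp add: vec_eq_iff forall_3)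
  then show "x = y" by (simp add: hvec_inject)
qed (simp add: mink_hvec_self)

lemma mink_gram_nonpos:
  "mink x x * (mink y y * mink z z - (mink y z)\<^sup>2) - mink x y * (mink x y * mink z z - mink y z * mink x z)
     + mink x z * (mink x y * mink y z - mink y y * mink x z) \<le> 0" (is "?g \<le> 0")
proof -
  have "?g = - (x$1 * (y$2 * z$3 - y$3 * z$2) - x$2 * (y$1 * z$3 - y$3 * z$1)
    + x$3 * (y$1 * z$2 - y$2 * z$1))\<^sup>2"
    unfolding mink_def by algebra
  then show ?thesis by simp
qed

instantiation hyp_plane :: metric_space
begin

definition dist_hyp_plane :: "hyp_plane \<Rightarrow> hyp_plane \<Rightarrow> real" where
  "dist x y = arcosh (- mink (hvec x) (hvec y))"

definition uniformity_hyp_plane :: "(hyp_plane \<times> hyp_plane) filter" where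
  "(uniformity :: (hyp_plane \<times> hyp_plane) filter) = (INF e\<in>{0 <..}. principal {(x, y). dist x y < e})"

definition open_hyp_plane :: "hyp_plane set \<Rightarrow> bool" where
  "open (U :: hyp_plane set) \<longleftrightarrow> (\<forall>x\<in>U. eventually (\<lambda>(x', y). x' = x \<longrightarrow> y \<in> U) uniformity)"

instance
proof
  fix x y z :: hyp_plane
  show "dist x y = 0 \<longleftrightarrow> x = y"
    unfolding dist_hyp_plane_def
    using mink_hvec_ge_1[of x y] mink_hvec_eq_1_iff[of x y] by simp
  define A C D where "A = - mink (hvec x) (hvec z)" and "C = - mink (hvec y) (hvec z)"
    and "D = - mink (hvec x) (hvec y)"
  have ge: "A \<ge> 1" "C \<ge> 1" "D \<ge> 1"
    unfolding A_def C_def D_def by (rule mink_hvec_ge_1)+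
  have "-1 * (1 - C\<^sup>2) + A * (A - C * D) - D * (A * C - D) \<le> 0"
    using mink_gram_nonpos[of "hvec x" "hvec z" "hvec y"] mink_commute[of "hvec z" "hvec y"]
    unfolding A_def C_def D_def mink_hvec_self
    by (simp add: algebra_simps)
  then have "(D - A * C)\<^sup>2 \<le> (A\<^sup>2 - 1) * (C\<^sup>2 - 1)"
    by (simp add: power2_eq_square algebra_simps)
  then have "\<bar>D - A * C\<bar> \<le> sqrt ((A\<^sup>2 - 1) * (C\<^sup>2 - 1))"
    using real_le_rsqrt by fastforce
  then have "D \<le> A * C + sqrt (A\<^sup>2 - 1) * sqrt (C\<^sup>2 - 1)"
    by (simp add: real_sqrt_mult)
  also have "\<dots> = cosh (arcosh A + arcosh C)"
    using ge by (simp add: cosh_add sinh_arcosh_real)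
  finally have "cosh (arcosh D) \<le> cosh (arcosh A + arcosh C)"
    using ge by simp
  then have "arcosh D \<le> arcosh A + arcosh C"
    using ge by (simp add: cosh_real_nonneg_le_iff del: cosh_arcosh_real)
  then show "dist x y \<le> dist x z + dist y z"
    by (simp add: dist_hyp_plane_def A_def C_def D_def)
qed (simp_all only: uniformity_hyp_plane_def open_hyp_plane_def)

end

section \<open>Segments, convexity, polygons\<close>

definition hseg :: "hyp_plane \<Rightarrow> hyp_plane \<Rightarrow> hyp_plane set" where
  "hseg x y = {z. dist x z + dist z y = dist x y}"

definition hconvex :: "hyp_plane set \<Rightarrow> bool" where
  "hconvex K \<longleftrightarrow> (\<forall>x\<in>K. \<forall>y\<in>K. hseg x y \<subseteq> K)"

definition hconvex_body :: "hyp_plane set \<Rightarrow> bool" where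
  "hconvex_body K \<longleftrightarrow> compact K \<and> hconvex K \<and> interior K \<noteq> {}"

definition hpolygon :: "hyp_plane set \<Rightarrow> bool" where
  "hpolygon P \<longleftrightarrow> hconvex_body P \<and> (\<exists>S. finite S \<and> P = hconvex hull S)"

definition hvertices :: "hyp_plane set \<Rightarrow> hyp_plane set" where
  "hvertices P = {v. \<exists>S. finite S \<and> P = hconvex hull S \<and> v \<in> S \<and> v \<notin> hconvex hull (S - {v})}"

text \<open>The radial projection of the hyperboloid to the plane \<open>x$3 = 1\<close> (the Klein model)
  multiplies the determinant below by a positive factor and turns it into the usual
  orientation determinant of three points of the plane.\<close>

definition pos_oriented :: "hyp_plane \<Rightarrow> hyp_plane \<Rightarrow> hyp_plane \<Rightarrow> bool" where
  "pos_oriented x y z \<longleftrightarrow> det (vector [hvec x, hvec y, hvec z] :: real^3^3) > 0"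

text \<open>\<open>P\<close> is an \<open>n\<close>-gon with vertices \<open>v 0, \<dots>, v (n - 1)\<close> in positively oriented cyclic order.\<close>

definition ngon_with_vertices :: "nat \<Rightarrow> (nat \<Rightarrow> hyp_plane) \<Rightarrow> hyp_plane set \<Rightarrow> bool" where
  "ngon_with_vertices n v P \<longleftrightarrow> hpolygon P \<and> bij_betw v {..<n} (hvertices P) \<and>
     (\<forall>i j k. i < j \<and> j < k \<and> k < n \<longrightarrow> pos_oriented (v i) (v j) (v k))"

section \<open>Lines, width, circumradius\<close>

text \<open>Lines are the sections of the hyperboloid by planes through the origin of \<open>real^3\<close>.
  The plane that is \<open>mink\<close>-orthogonal to \<open>a \<noteq> 0\<close> meets the hyperboloid iff \<open>mink a a > 0\<close>.\<close>

definition hline_of :: "real^3 \<Rightarrow> hyp_plane set" where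
  "hline_of a = {x. mink a (hvec x) = 0}"

definition hhalfplane_of :: "real^3 \<Rightarrow> hyp_plane set" where
  "hhalfplane_of a = {x. mink a (hvec x) \<ge> 0}"

definition hline :: "hyp_plane set \<Rightarrow> bool" where
  "hline l \<longleftrightarrow> (\<exists>a. mink a a > 0 \<and> l = hline_of a)"

definition hperpendicular :: "hyp_plane set \<Rightarrow> hyp_plane set \<Rightarrow> bool" where
  "hperpendicular l m \<longleftrightarrow>
     (\<exists>a b. mink a a > 0 \<and> mink b b > 0 \<and> l = hline_of a \<and> m = hline_of b \<and> mink a b = 0)"

text \<open>\<open>p\<close> is the orthogonal projection of \<open>x\<close> onto the line \<open>l\<close>. For \<open>x \<in> l\<close> this forces
  \<open>p = x\<close>.\<close>

definition horth_proj :: "hyp_plane set \<Rightarrow> hyp_plane \<Rightarrow> hyp_plane \<Rightarrow> bool" where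
  "horth_proj l x p \<longleftrightarrow> p \<in> l \<and> (\<exists>m. hperpendicular l m \<and> x \<in> m \<and> p \<in> m)"

text \<open>Replacing \<open>a\<close> by \<open>- a\<close> gives the same line and the other half-plane.\<close>

definition supporting_line :: "hyp_plane set \<Rightarrow> hyp_plane set \<Rightarrow> bool" where
  "supporting_line K l \<longleftrightarrow>
     (\<exists>a. mink a a > 0 \<and> l = hline_of a \<and> K \<inter> l \<noteq> {} \<and> K \<subseteq> hhalfplane_of a)"

text \<open>For a convex body the supremum, the infimum, and the infimum in the circumradius are all
  attained.\<close>

definition hwidth :: "hyp_plane set \<Rightarrow> hyp_plane set \<Rightarrow> real" where
  "hwidth K l = (SUP l' \<in> {l'. supporting_line K l'}. setdist l l')"

definition hmin_width :: "hyp_plane set \<Rightarrow> real" where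
  "hmin_width K = (INF l \<in> {l. supporting_line K l}. hwidth K l)"

definition hcircumradius :: "hyp_plane set \<Rightarrow> real" where
  "hcircumradius P = Inf {r. \<exists>c. P \<subseteq> cball c r}"

section \<open>Ordinary reduced polygons\<close>

text \<open>Vertex indices are taken modulo \<open>n\<close>; the relative interior of the side \<open>[a, b]\<close> is the
  segment without its endpoints.\<close>

definition ordinary_reduced_ngon :: "nat \<Rightarrow> (nat \<Rightarrow> hyp_plane) \<Rightarrow> hyp_plane set \<Rightarrow> bool" where
  "ordinary_reduced_ngon n v P \<longleftrightarrow> n \<ge> 3 \<and> odd n \<and> ngon_with_vertices n v P \<and>
     (\<forall>i<n. let a = v ((i + (n - 1) div 2) mod n); b = v ((i + (n + 1) div 2) mod n) in
        infdist (v i) (hseg a b) = hmin_width P \<and>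
        (\<exists>l p. hline l \<and> a \<in> l \<and> b \<in> l \<and> horth_proj l (v i) p \<and> p \<in> hseg a b - {a, b}))"

definition ordinary_reduced_polygon :: "hyp_plane set \<Rightarrow> bool" where
  "ordinary_reduced_polygon P \<longleftrightarrow> (\<exists>n v. ordinary_reduced_ngon n v P)"

definition regular_triangle :: "hyp_plane set \<Rightarrow> bool" where
  "regular_triangle P \<longleftrightarrow> hpolygon P \<and> card (hvertices P) = 3 \<and>
     (\<exists>s. \<forall>x\<in>hvertices P. \<forall>y\<in>hvertices P. x \<noteq> y \<longrightarrow> dist x y = s)"

end

theory Submission
  imports Defs
begin

text \<open>
  Let \<open>a\<close> be the side of the regular triangle of height \<open>w\<close>; by Pythagoras it is determined by
  \<open>cosh a = cosh w * cosh (a/2)\<close>, a quadratic equation for \<open>cosh (a/2)\<close>. The asserted bound is the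
  circumradius of this triangle, and by Jung's theorem it bounds the circumradius of every set of
  diameter at most \<open>a\<close>. So the point is that any two vertices have distance at most \<open>a\<close>, with
  equality only for neighbouring vertices (lemma \<open>vertex_distance_bound\<close>). If the circumradius is
  extremal, then Jung's theorem gives three vertices with pairwise distance \<open>a\<close>; they are pairwise
  neighbours, hence the polygon is a triangle, and it is regular. Conversely, a regular triangle whose
  altitudes have length \<open>w\<close> has the side \<open>a\<close>, and no disk smaller than asserted contains its vertices.

  The distance bound rests on two observations. Let \<open>n = 2m + 1\<close> be the number of vertices, and call
  the segment from a vertex to its projection on the opposite side an altitude. All altitudes have
  length \<open>w\<close>.

  The first observation concerns lengths. The vertices \<open>v k\<close> and \<open>v (k + m)\<close> lie on the opposite
  sides of each other, so their altitudes are legs of two right triangles with the common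
  hypotenuse \<open>[v k, v (k + m)]\<close>. These triangles are congruent. Adding up the second legs along the
  boundary shows that the boundary path with at most \<open>m\<close> sides between two vertices \<open>X\<close>, \<open>Y\<close> is as long as
  the boundary path on the opposite side of the polygon between the feet \<open>T1\<close>, \<open>T2\<close> of their altitudes (lemma \<open>opposite_chain_length\<close>).

  The second observation concerns positions. The path from \<open>T1\<close> to \<open>T2\<close> is convex and starts and ends
  along the sides opposite to \<open>X\<close> and \<open>Y\<close>. If \<open>d = dist X Y \<ge> a\<close>, then the lines of these sides meet
  in a point \<open>Q\<close> of the equilateral triangle erected on \<open>[X, Y]\<close>, and each of \<open>T1\<close>, \<open>T2\<close> has distance
  at most \<open>d/2\<close> from \<open>Q\<close>, with strict inequality if \<open>d > a\<close> (lemma \<open>crossing_altitudes\<close>). A convex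
  path inside the triangle \<open>T1 Q T2\<close> is no longer than the two sides at \<open>Q\<close> (lemma
  \<open>convex_chain_length\<close>).

  Together, if \<open>d \<ge> a\<close> then the boundary path from \<open>X\<close> to \<open>Y\<close> has length at most \<open>d\<close>, and less if
  \<open>d > a\<close>. The triangle inequality excludes \<open>d > a\<close>, and for \<open>d = a\<close> it makes the path straight, which
  means that \<open>X\<close> and \<open>Y\<close> are neighbours.

  Everything is computed in the hyperboloid model. Incidence and order of points are read off from
  signs of determinants, and new points are positive combinations of old ones.
\<close>

section \<open>The Minkowski form and determinants\<close>

text \<open>For points of the hyperboloid the sign of this determinant is the orientation of the triangle, and
  \<open>tri x y\<close> is a linear functional whose zero set is the line through \<open>x\<close> and \<open>y\<close>.\<close>
definition tri :: "real^3 \<Rightarrow> real^3 \<Rightarrow> real^3 \<Rightarrow> real" where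
  "tri x y z = det (vector [x, y, z] :: real^3^3)"

lemma tri_expand:
  "tri x y z = x$1 * (y$2 * z$3 - y$3 * z$2) - x$2 * (y$1 * z$3 - y$3 * z$1)
     + x$3 * (y$1 * z$2 - y$2 * z$1)"
  by (simp add: tri_def det_3 algebra_simps)

lemma mink_linear [simp]:
  "mink (x + y) z = mink x z + mink y z" "mink z (x + y) = mink z x + mink z y"
  "mink (x - y) z = mink x z - mink y z" "mink z (x - y) = mink z x - mink z y"
  "mink (r *\<^sub>R x) z = r * mink x z" "mink z (r *\<^sub>R x) = r * mink z x"
  by (simp_all add: mink_def algebra_simps)

lemma tri_linear [simp]:
  "tri (x + x') y z = tri x y z + tri x' y z" "tri x (y + y') z = tri x y z + tri x y' z"
  "tri x y (z + z') = tri x y z + tri x y z'"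
  "tri (x - x') y z = tri x y z - tri x' y z" "tri x (y - y') z = tri x y z - tri x y' z"
  "tri x y (z - z') = tri x y z - tri x y z'"
  "tri (r *\<^sub>R x) y z = r * tri x y z" "tri x (r *\<^sub>R y) z = r * tri x y z"
  "tri x y (r *\<^sub>R z) = r * tri x y z"
  by (simp_all add: tri_expand algebra_simps)

lemma tri_degenerate [simp]: "tri x x y = 0" "tri x y x = 0" "tri y x x = 0"
  by (simp_all add: tri_expand algebra_simps)

lemma tri_rotate: "tri x y z = tri y z x"
  by (simp add: tri_expand algebra_simps)

lemma tri_swap: "tri x y z = - tri y x z"
  by (simp add: tri_expand algebra_simps)

lemma tri_reverse: "tri x y z = - tri z y x"
  by (simp add: tri_expand algebra_simps)

text \<open>Cramer's rule: the coordinates of \<open>u\<close> with respect to \<open>x, y, z\<close>, without a division.\<close>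
lemma tri_cramer:
  "tri x y z *\<^sub>R u = tri u y z *\<^sub>R x + tri x u z *\<^sub>R y + tri x y u *\<^sub>R z"
  unfolding vec_eq_iff forall_3 tri_expand by (simp add: algebra_simps)

lemma tri_gram:
  "(tri x y z)\<^sup>2 = - (mink x x * (mink y y * mink z z - (mink y z)\<^sup>2)
     - mink x y * (mink x y * mink z z - mink y z * mink x z)
     + mink x z * (mink x y * mink y z - mink y y * mink x z))"
  unfolding tri_expand mink_def by algebra

text \<open>The Lorentzian cross product: the vector that represents the functional \<open>tri x y\<close> with respect to
  the form \<open>mink\<close>.\<close>
definition lcross :: "real^3 \<Rightarrow> real^3 \<Rightarrow> real^3" where
  "lcross x y = vector [x$2 * y$3 - x$3 * y$2, x$3 * y$1 - x$1 * y$3, x$2 * y$1 - x$1 * y$2]"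

lemma mink_lcross: "mink (lcross x y) z = tri x y z"
  by (simp add: mink_def lcross_def tri_expand algebra_simps)

lemma mink_lcross_self: "mink (lcross x y) (lcross x y) = (mink x y)\<^sup>2 - mink x x * mink y y"
  by (simp add: mink_def lcross_def power2_eq_square algebra_simps)

section \<open>Points of the hyperboloid\<close>

lemma cosh_dist: "cosh (dist x y) = - mink (hvec x) (hvec y)"
  unfolding dist_hyp_plane_def using mink_hvec_ge_1[of x y] by simp

lemma mink_hvec: "mink (hvec x) (hvec y) = - cosh (dist x y)"
  by (simp add: cosh_dist)

lemma cosh_dist_eq_iff: "cosh (dist x y) = cosh (dist u v) \<longleftrightarrow> dist x y = dist u v"
  using cosh_real_nonneg_le_iff[of "dist x y" "dist u v"] cosh_real_nonneg_le_iff[of "dist u v" "dist x y"] by auto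

text \<open>For both vectors the third coordinate is positive and at least the Euclidean norm of the first two, so
  this is the Cauchy-Schwarz inequality in the first two coordinates.\<close>
lemma mink_future_neg:
  assumes "mink u u \<le> 0" "u$3 > 0" shows "mink u (hvec x) < 0"
proof -
  let ?x = "hvec x"
  have x: "(?x$1)\<^sup>2 + (?x$2)\<^sup>2 < (?x$3)\<^sup>2" "?x$3 > 0"
    using mink_hvec_self[of x] hvec_3_pos[of x] by (auto simp: mink_def power2_eq_square)
  have u: "(u$1)\<^sup>2 + (u$2)\<^sup>2 \<le> (u$3)\<^sup>2"
    using assms(1) by (simp add: mink_def power2_eq_square)
  have "(u$1 * ?x$1 + u$2 * ?x$2)\<^sup>2 \<le> ((u$1)\<^sup>2 + (u$2)\<^sup>2) * ((?x$1)\<^sup>2 + (?x$2)\<^sup>2)"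
  proof -
    have "((u$1)\<^sup>2 + (u$2)\<^sup>2) * ((?x$1)\<^sup>2 + (?x$2)\<^sup>2) = (u$1 * ?x$1 + u$2 * ?x$2)\<^sup>2 + (u$1 * ?x$2 - u$2 * ?x$1)\<^sup>2"
      by algebra
    then show ?thesis by simp
  qed
  also have "\<dots> \<le> (u$3)\<^sup>2 * ((?x$1)\<^sup>2 + (?x$2)\<^sup>2)"
    using u by (intro mult_right_mono) auto
  also have "\<dots> < (u$3)\<^sup>2 * (?x$3)\<^sup>2"
    using x assms(2) by (intro mult_strict_left_mono) auto
  finally have "(u$1 * ?x$1 + u$2 * ?x$2)\<^sup>2 < (u$3 * ?x$3)\<^sup>2" by (simp add: power_mult_distrib)
  then have "u$1 * ?x$1 + u$2 * ?x$2 < u$3 * ?x$3"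
    using x assms(2) power2_less_imp_less[of "u$1 * ?x$1 + u$2 * ?x$2" "u$3 * ?x$3"] by simp
  then show ?thesis by (simp add: mink_def)
qed

lemma future_of_neg:
  assumes "mink u u \<le> 0" "mink u (hvec x) < 0" shows "u$3 > 0"
proof (rule ccontr)
  assume "\<not> u$3 > 0"
  moreover have "u$3 \<noteq> 0"
  proof
    assume "u$3 = 0"
    then have "(u$1)\<^sup>2 + (u$2)\<^sup>2 \<le> 0" using assms(1) by (simp add: mink_def power2_eq_square)
    then have "u$1 = 0" "u$2 = 0" by (simp_all add: sum_power2_le_zero_iff)
    then show False using assms(2) \<open>u$3 = 0\<close> by (simp add: mink_def)
  qed
  ultimately have "(- u)$3 > 0" by simp
  moreover have "mink (- u) (- u) \<le> 0" using assms(1) by (simp add: mink_def)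
  ultimately have "mink (- u) (hvec x) < 0" by (rule mink_future_neg[rotated])
  then show False using assms(2) by (simp add: mink_def)
qed

lemma hvec_eqI:
  assumes "mink u u = -1" "u$3 > 0"
  obtains z where "hvec z = u"
  using Abs_hyp_inverse[of u] assms by blast

text \<open>Every vector inside the future light cone is a positive multiple of a point. This is how
  intersection points of lines are constructed.\<close>
lemma future_normalise:
  assumes "mink u u < 0" "u$3 > 0"
  obtains z k where "k > 0" "hvec z = k *\<^sub>R u"
proof -
  define k where "k = 1 / sqrt (- mink u u)"
  have k: "k > 0" "k\<^sup>2 * mink u u = -1" using assms(1) by (auto simp: k_def power_divide)
  have "mink (k *\<^sub>R u) (k *\<^sub>R u) = -1" using k by (simp add: power2_eq_square)
  then have "hvec (Abs_hyp (k *\<^sub>R u)) = k *\<^sub>R u"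
    using k assms(2) by (intro Abs_hyp_inverse) auto
  then show ?thesis using k that by blast
qed

text \<open>The open future cone is convex: since \<open>- mink (hvec x) (hvec y) \<ge> 1\<close>, the vector \<open>u\<close> satisfies
  \<open>- mink u u \<ge> (a + b + c)\<^sup>2\<close>.\<close>
lemma nonneg_comb_future:
  fixes a b c :: real and x y z :: hyp_plane
  assumes "a \<ge> 0" "b \<ge> 0" "c \<ge> 0" "a + b + c > 0"
  defines "u \<equiv> a *\<^sub>R hvec x + b *\<^sub>R hvec y + c *\<^sub>R hvec z"
  shows "mink u u < 0" "u$3 > 0"
proof -
  have e: "mink u u = - (a\<^sup>2 + b\<^sup>2 + c\<^sup>2 + 2*a*b*cosh (dist x y) + 2*a*c*cosh (dist x z) + 2*b*c*cosh (dist y z))"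
    unfolding u_def by (simp add: mink_hvec dist_commute power2_eq_square algebra_simps)
  have "2*a*b*cosh (dist x y) \<ge> 2*a*b" "2*a*c*cosh (dist x z) \<ge> 2*a*c" "2*b*c*cosh (dist y z) \<ge> 2*b*c"
    using assms mult_left_mono[OF cosh_real_ge_1, of "2*a*b" "dist x y"]
     mult_left_mono[OF cosh_real_ge_1, of "2*a*c" "dist x z"] mult_left_mono[OF cosh_real_ge_1, of "2*b*c" "dist y z"] by auto
  then have "mink u u \<le> - (a+b+c)\<^sup>2" unfolding e by (simp add: power2_eq_square algebra_simps)
  also have "\<dots> < 0" using assms by simp
  finally show "mink u u < 0" .
  have "a * hvec x $ 3 \<ge> 0" "b * hvec y $ 3 \<ge> 0" "c * hvec z $ 3 \<ge> 0"
    using assms hvec_3_pos by (auto intro: mult_nonneg_nonneg less_imp_le)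
  moreover have "a > 0 \<or> b > 0 \<or> c > 0" using assms by linarith
  then have "a * hvec x $ 3 > 0 \<or> b * hvec y $ 3 > 0 \<or> c * hvec z $ 3 > 0"
    using hvec_3_pos by auto
  ultimately show "u$3 > 0" unfolding u_def by auto
qed

section \<open>Segments and disks\<close>

text \<open>The addition theorem for \<open>cosh\<close>: \<open>sinh (dist x z) = b * sinh (dist x y)\<close> and
  \<open>sinh (dist z y) = a * sinh (dist x y)\<close>.\<close>
lemma hseg_comb:
  assumes z: "hvec z = a *\<^sub>R hvec x + b *\<^sub>R hvec y" and ab: "a \<ge> 0" "b \<ge> 0"
  shows "z \<in> hseg x y"
proof -
  define C where "C = cosh (dist x y)"
  have one: "a\<^sup>2 + b\<^sup>2 + 2*a*b*C = 1"
    using mink_hvec_self[of z] unfolding z C_def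
    by (simp add: mink_hvec dist_commute power2_eq_square algebra_simps)
  have c1: "cosh (dist x z) = a + b * C" "cosh (dist z y) = a * C + b"
    unfolding cosh_dist z C_def by (simp_all add: mink_hvec dist_commute)
  have "(a + b * C)\<^sup>2 - (a\<^sup>2 + b\<^sup>2 + 2*a*b*C) = b\<^sup>2 * (C\<^sup>2 - 1)" by algebra
  then have "(sinh (dist x z))\<^sup>2 = (b * sinh (dist x y))\<^sup>2"
    unfolding one by (simp add: sinh_square_eq c1 power_mult_distrib C_def[symmetric])
  then have s1: "sinh (dist x z) = b * sinh (dist x y)"
    using ab by (simp add: power2_eq_iff_nonneg)
  have "(a * C + b)\<^sup>2 - (a\<^sup>2 + b\<^sup>2 + 2*a*b*C) = a\<^sup>2 * (C\<^sup>2 - 1)" by algebra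
  then have "(sinh (dist z y))\<^sup>2 = (a * sinh (dist x y))\<^sup>2"
    unfolding one by (simp add: sinh_square_eq c1 power_mult_distrib C_def[symmetric])
  then have s2: "sinh (dist z y) = a * sinh (dist x y)"
    using ab by (simp add: power2_eq_iff_nonneg)
  have "cosh (dist x z + dist z y) = (a + b*C)*(a*C+b) + a*b*(sinh (dist x y))\<^sup>2"
    by (simp add: cosh_add c1 s1 s2 power2_eq_square)
  also have "\<dots> = C * (a\<^sup>2 + b\<^sup>2 + 2*a*b*C)"
    by (simp add: sinh_square_eq C_def[symmetric]) algebra
  also have "\<dots> = C" by (simp add: one)
  finally have "cosh (dist x z + dist z y) = cosh (dist x y)" by (simp add: C_def)
  then have "dist x z + dist z y = dist x y"
    using cosh_real_nonneg_le_iff[of "dist x z + dist z y" "dist x y"]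
      cosh_real_nonneg_le_iff[of "dist x y" "dist x z + dist z y"] by simp
  then show ?thesis by (simp add: hseg_def)
qed

text \<open>The converse: the combination with the coefficients \<open>sinh (dist z y) / sinh (dist x y)\<close> and
  \<open>sinh (dist x z) / sinh (dist x y)\<close> is a point at distance zero from \<open>z\<close>.\<close>
lemma hseg_imp_comb:
  assumes "z \<in> hseg x y"
  obtains a b where "a \<ge> 0" "b \<ge> 0" "hvec z = a *\<^sub>R hvec x + b *\<^sub>R hvec y" "z \<noteq> x \<Longrightarrow> b > 0" "z \<noteq> y \<Longrightarrow> a > 0"
proof (cases "x = y")
  case True
  then have "z = x" "z = y" using assms by (auto simp: hseg_def dist_commute)
  then show ?thesis using that[of 1 0] by auto
next
  case False
  define d1 d2 where "d1 = dist x z" and "d2 = dist z y"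
  have d: "dist x y = d1 + d2" "d1 \<ge> 0" "d2 \<ge> 0" using assms by (auto simp: hseg_def d1_def d2_def)
  have pos: "sinh (d1 + d2) > 0" using False d by (simp flip: d(1))
  define a b where "a = sinh d2 / sinh (d1 + d2)" and "b = sinh d1 / sinh (d1+d2)"
  have ab: "a \<ge> 0" "b \<ge> 0" using d pos by (auto simp: a_def b_def)
  have ab': "z \<noteq> y \<Longrightarrow> a > 0" "z \<noteq> x \<Longrightarrow> b > 0" using pos by (auto simp: a_def b_def d1_def d2_def)
  let ?u = "a *\<^sub>R hvec x + b *\<^sub>R hvec y"
  have "mink ?u ?u = - (a\<^sup>2 + b\<^sup>2 + 2*a*b*cosh (d1+d2))"
    using d(1) by (simp add: mink_hvec dist_commute power2_eq_square algebra_simps)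
  also have "\<dots> = - ((sinh d2)\<^sup>2 + (sinh d1)\<^sup>2 + 2 * sinh d1 * sinh d2 * cosh (d1+d2)) / (sinh (d1+d2))\<^sup>2"
    using pos by (simp add: a_def b_def power_divide divide_simps power2_eq_square)
  also have "(sinh d2)\<^sup>2 + (sinh d1)\<^sup>2 + 2 * sinh d1 * sinh d2 * cosh (d1+d2) = (sinh (d1+d2))\<^sup>2"
  proof -
    have "s2\<^sup>2 + s1\<^sup>2 + 2 * s1 * s2 * (c1 * c2 + s1 * s2) = (s1 * c2 + c1 * s2)\<^sup>2"
      if "c1\<^sup>2 = s1\<^sup>2 + 1" "c2\<^sup>2 = s2\<^sup>2 + 1" for s1 s2 c1 c2 :: real
    proof -
      have "(s1 * c2 + c1 * s2)\<^sup>2 = s1\<^sup>2 * c2\<^sup>2 + c1\<^sup>2 * s2\<^sup>2 + 2 * s1 * s2 * (c1 * c2)" by algebra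
      then show ?thesis unfolding that by (simp add: power2_eq_square algebra_simps)
    qed
    from this[OF cosh_square_eq cosh_square_eq] show ?thesis by (simp add: sinh_add cosh_add)
  qed
  finally have uu: "mink ?u ?u = -1" using pos by simp
  have "a \<noteq> 0 \<or> b \<noteq> 0" using uu by (auto simp: mink_def)
  then have "?u $ 3 > 0" using ab nonneg_comb_future(2)[of a b 0 x y x] by auto
  then obtain z' where z': "hvec z' = ?u" using uu hvec_eqI by blast
  have "mink (hvec z) (hvec z') = - (a * cosh d1 + b * cosh d2)"
    unfolding z' by (simp add: mink_hvec dist_commute d1_def d2_def)
  also have "a * cosh d1 + b * cosh d2 = 1"
    using pos by (simp add: a_def b_def divide_simps) (simp add: sinh_add)
  finally have "z = z'" using mink_hvec_eq_1_iff[of z z'] by simp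
  then show ?thesis using that ab ab' z' by auto
qed

lemma hseg_endpoints [simp]: "x \<in> hseg x y" "y \<in> hseg x y"
  by (auto simp: hseg_def)

lemma hseg_commute: "hseg x y = hseg y x"
  by (auto simp: hseg_def dist_commute)

lemma hseg_extend:
  assumes "c1 \<in> hseg c0 p" "q \<in> hseg c1 p"
  shows "c1 \<in> hseg c0 q" "dist c0 q + dist q p = dist c0 p"
  using assms dist_triangle[of c0 q c1] dist_triangle[of c0 p q] by (auto simp: hseg_def)

lemma hseg_trans:
  assumes "c1 \<in> hseg c0 p" "q \<in> hseg c0 c1"
  shows "q \<in> hseg c0 p"
  using assms dist_triangle[of q p c1] dist_triangle[of c0 p q] by (auto simp: hseg_def)

text \<open>Disks are convex. The coefficients of a point satisfy \<open>a + b + c \<le> 1\<close>, and \<open>cosh (dist q p)\<close> is the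
  corresponding combination of the values at \<open>x\<close>, \<open>y\<close>, \<open>z\<close>.\<close>
lemma dist_comb_le:
  assumes o: "hvec p = a *\<^sub>R hvec x + b *\<^sub>R hvec y + c *\<^sub>R hvec z" and "a \<ge> 0" "b \<ge> 0" "c \<ge> 0"
    and "dist q x \<le> r" "dist q y \<le> r" "dist q z \<le> r"
  shows "dist q p \<le> r"
proof -
  have r: "r \<ge> 0" using assms(5) zero_le_dist order_trans by blast
  have e: "1 = (a\<^sup>2 + b\<^sup>2 + c\<^sup>2 + 2*a*b*cosh (dist x y) + 2*a*c*cosh (dist x z) + 2*b*c*cosh (dist y z))"
    using mink_hvec_self[of p] unfolding o by (simp add: mink_hvec dist_commute power2_eq_square algebra_simps)
  have "2*a*b*cosh (dist x y) \<ge> 2*a*b" "2*a*c*cosh (dist x z) \<ge> 2*a*c" "2*b*c*cosh (dist y z) \<ge> 2*b*c"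
    using assms mult_left_mono[OF cosh_real_ge_1, of "2*a*b" "dist x y"]
     mult_left_mono[OF cosh_real_ge_1, of "2*a*c" "dist x z"] mult_left_mono[OF cosh_real_ge_1, of "2*b*c" "dist y z"] by auto
  then have "(a+b+c)\<^sup>2 \<le> 1\<^sup>2" using e by (simp add: power2_eq_square algebra_simps)
  then have s: "a + b + c \<le> 1" by (rule power2_le_imp_le) simp
  have "cosh (dist q p) = a * cosh (dist q x) + b * cosh (dist q y) + c * cosh (dist q z)"
    unfolding cosh_dist o by simp
  also have "\<dots> \<le> a * cosh r + b * cosh r + c * cosh r"
    using assms r by (intro add_mono mult_left_mono) (auto simp: cosh_real_nonneg_le_iff)
  also have "\<dots> = (a + b + c) * cosh r" by (simp add: algebra_simps)
  also have "\<dots> \<le> 1 * cosh r" using s by (intro mult_right_mono) (auto simp: cosh_real_nonneg)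
  finally show ?thesis using r by (simp add: cosh_real_nonneg_le_iff)
qed

lemma hconvex_cball: "hconvex (cball c r)"
  unfolding hconvex_def
proof (intro ballI subsetI)
  fix x y z assume "x \<in> cball c r" "y \<in> cball c r" "z \<in> hseg x y"
  moreover from this obtain a b where "a \<ge> 0" "b \<ge> 0" "hvec z = a *\<^sub>R hvec x + b *\<^sub>R hvec y"
    using hseg_imp_comb by metis
  ultimately show "z \<in> cball c r" using dist_comb_le[of z a x b y 0 x c r] by auto
qed

section \<open>Right angles\<close>

text \<open>The normals of the two perpendicular lines and \<open>p\<close> form an orthogonal basis. Only the \<open>p\<close>-component
  is shared by \<open>x\<close> and \<open>z\<close>, because \<open>x\<close> has no component along one normal and \<open>z\<close> none along the other.\<close>
lemma orth_proj_pythagoras: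
  assumes "horth_proj l x p" "z \<in> l"
  shows "mink (hvec x) (hvec z) = - mink (hvec x) (hvec p) * mink (hvec p) (hvec z)"
proof -
  obtain m where m: "p \<in> l" "hperpendicular l m" "x \<in> m" "p \<in> m" using assms by (auto simp: horth_proj_def)
  then obtain a b where ab: "mink a a > 0" "mink b b > 0" "l = hline_of a" "m = hline_of b" "mink a b = 0"
    by (auto simp: hperpendicular_def)
  let ?x = "hvec x" and ?p = "hvec p" and ?z = "hvec z"
  have o: "mink a ?p = 0" "mink b ?p = 0" "mink b ?x = 0" "mink a ?z = 0"
    using m ab assms(2) by (auto simp: hline_of_def)
  have "(tri a b ?p)\<^sup>2 = mink a a * mink b b" unfolding tri_gram using ab o mink_hvec_self[of p] by simp
  then have nz: "tri a b ?p \<noteq> 0" using ab by auto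
  have c: "tri a b ?p * mink u ?x = tri ?x b ?p * mink u a + tri a ?x ?p * mink u b + tri a b ?x * mink u ?p" for u
    using arg_cong[OF tri_cramer[of a b ?p ?x], of "mink u"] by simp
  have "tri a ?x ?p = 0" using c[of b] ab o by (simp add: mink_commute)
  moreover have "tri a b ?p * mink ?p ?x = - tri a b ?x"
    using c[of ?p] ab o mink_hvec_self[of p] by (simp add: mink_commute)
  moreover have "tri a b ?p * mink ?z ?x = tri a b ?x * mink ?z ?p + tri a ?x ?p * mink ?z b"
    using c[of ?z] o by (simp add: mink_commute)
  ultimately have "tri a b ?p * mink ?z ?x = tri a b ?p * (- mink ?p ?x * mink ?z ?p)" by algebra
  then have "mink ?z ?x = - mink ?p ?x * mink ?z ?p" using nz by (metis mult_left_cancel)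
  then show ?thesis by (simp add: mink_commute)
qed

lemma orth_proj_right_angle:
  assumes "horth_proj l x p" "z \<in> l"
  shows "cosh (dist x z) = cosh (dist x p) * cosh (dist p z)"
  using orth_proj_pythagoras[OF assms] by (simp add: mink_hvec)

lemma hseg_subset_hline:
  assumes "hline l" "a \<in> l" "b \<in> l" "z \<in> hseg a b"
  shows "z \<in> l"
proof -
  obtain s t where "hvec z = s *\<^sub>R hvec a + t *\<^sub>R hvec b" using hseg_imp_comb[OF assms(4)] by metis
  then show ?thesis using assms(1-3) by (auto simp: hline_def hline_of_def)
qed

lemma infdist_orth_proj:
  assumes "hline l" "a \<in> l" "b \<in> l" "horth_proj l x p" "p \<in> hseg a b"
  shows "infdist x (hseg a b) = dist x p"
proof (rule antisym)
  show "infdist x (hseg a b) \<le> dist x p" using assms(5) by (rule infdist_le)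
  have "dist x p \<le> dist x z" if "z \<in> hseg a b" for z
  proof -
    have "cosh (dist x z) = cosh (dist x p) * cosh (dist p z)"
      using orth_proj_right_angle assms(4) hseg_subset_hline[OF assms(1-3) that] by blast
    moreover have "cosh (dist x p) * 1 \<le> cosh (dist x p) * cosh (dist p z)"
      by (intro mult_left_mono cosh_real_ge_1) (simp add: cosh_real_nonneg)
    ultimately have "cosh (dist x p) \<le> cosh (dist x z)" by linarith
    then show ?thesis by (simp add: cosh_real_nonneg_le_iff)
  qed
  then show "dist x p \<le> infdist x (hseg a b)"
    using assms(5) by (subst infdist_notempty) (auto intro!: cINF_greatest)
qed

text \<open>A right angle at \<open>T\<close>, with \<open>Y\<close> in the angle between the rays from \<open>Q\<close> to \<open>T\<close> and to \<open>X\<close>. Turning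
  \<open>Y\<close> around \<open>Q\<close> onto the ray through \<open>T\<close> does not decrease the angle at \<open>Q\<close> between \<open>X\<close> and \<open>Y\<close>, hence
  not the distance from \<open>X\<close>. After the turn \<open>Y\<close> has distance
  \<open>\<bar>dist Q Y - dist T Q\<bar>\<close> from \<open>T\<close>, and Pythagoras gives the right-hand side.

  In the proof, \<open>y1\<close> and \<open>y2\<close> are the components of \<open>Y\<close> in the tangent plane at \<open>Q\<close>, along and
  perpendicular to the line \<open>Q T\<close>.\<close>
lemma hinge:
  assumes right: "cosh (dist X Q) = cosh (dist X T) * cosh (dist T Q)"
    and Y: "hvec Y = a *\<^sub>R hvec Q + b *\<^sub>R hvec T + c *\<^sub>R hvec X" and nn: "b \<ge> 0" "c \<ge> 0" and "X \<noteq> T" "Q \<noteq> T"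
  shows "cosh (dist X Y) \<le> cosh (dist X T) * cosh (dist Q Y - dist T Q)"
proof -
  define K s ch th where "K = cosh (dist X T)" and "s = sinh (dist X T)" and "ch = cosh (dist T Q)" and "th = sinh (dist T Q)"
  define y1 y2 where "y1 = (b + K*c)*th" and "y2 = s*c"
  have K: "K \<ge> 1" "s > 0" "th > 0" "K^2 = 1 + s^2" "ch^2 = 1 + th^2"
    using assms by (simp_all add: K_def s_def th_def ch_def cosh_real_ge_1 cosh_square_eq zero_less_dist_iff)
  have y: "y1 \<ge> 0" "y2 \<ge> 0" using nn K by (simp_all add: y1_def y2_def)
  have cq: "cosh (dist Q Y) = a + b * ch + c * (K * ch)"
    unfolding cosh_dist Y using right by (simp add: mink_hvec K_def ch_def dist_commute)
  have one: "a\<^sup>2 + b\<^sup>2 + c\<^sup>2 + 2*a*b*ch + 2*a*c*(K*ch) + 2*b*c*K = 1"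
    using mink_hvec_self[of Y] right unfolding Y
    by (simp add: mink_hvec K_def ch_def dist_commute power2_eq_square algebra_simps)
  have cXY: "cosh (dist X Y) = a * (K*ch) + b * K + c"
    unfolding cosh_dist[of X Y] Y using right by (simp add: mink_hvec K_def ch_def dist_commute)
  have sq: "(sinh (dist Q Y))\<^sup>2 = y1\<^sup>2 + y2\<^sup>2"
  proof -
    have "(sinh (dist Q Y))\<^sup>2 = (a + b * ch + c * (K * ch))\<^sup>2 - (a\<^sup>2 + b\<^sup>2 + c\<^sup>2 + 2*a*b*ch + 2*a*c*(K*ch) + 2*b*c*K)"
      by (simp add: sinh_square_eq cq one)
    also have "\<dots> = (b + K*c)\<^sup>2 * (ch\<^sup>2 - 1) + (K\<^sup>2 - 1) * c\<^sup>2"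
      by (simp add: power2_eq_square algebra_simps)
    also have "\<dots> = y1\<^sup>2 + y2\<^sup>2" by (simp add: y1_def y2_def K(4,5) power_mult_distrib)
    finally show ?thesis .
  qed
  define e where "e = s * y2 / (K*th)"
  have e: "e \<ge> 0" "(K*th) * e = s * y2" using y K by (simp_all add: e_def)
  have "s * y1 = (K*th) * y2 + s * b * th" by (simp add: y1_def y2_def algebra_simps)
  moreover have "s * b * th \<ge> 0" using nn K by simp
  ultimately have "(K*th) * y2 \<le> s * y1" by linarith
  then have "((K*th) * y2) * y2 \<le> (s * y1) * y2" using y by (intro mult_right_mono) auto
  moreover have "(s * y1) * y2 = y1 * ((K*th) * e)" unfolding e(2) by (simp only: ac_simps)
  ultimately have "(K*th) * y2\<^sup>2 \<le> (K*th) * (y1 * e)" by (simp only: power2_eq_square ac_simps)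
  moreover have "K*th > 0" using K by simp
  ultimately have "y2\<^sup>2 \<le> y1 * e" by (simp only: mult_le_cancel_left_pos)
  moreover have "y1 * e \<ge> 0" using y e by simp
  moreover have "(y1 + e)\<^sup>2 = y1\<^sup>2 + 2 * (y1 * e) + e\<^sup>2" by (simp add: power2_sum)
  ultimately have "(sinh (dist Q Y))\<^sup>2 \<le> (y1 + e)\<^sup>2" unfolding sq using zero_le_power2[of e] by linarith
  moreover have "0 \<le> y1 + e" using y e by simp
  ultimately have "sinh (dist Q Y) \<le> y1 + e" by (rule power2_le_imp_le)
  then have "(K*th) * sinh (dist Q Y) \<le> (K*th) * (y1 + e)"
    using K by (intro mult_left_mono) auto
  also have "\<dots> = K*th*y1 + s*y2" unfolding distrib_left e(2) ..
  finally have le: "(K*th) * sinh (dist Q Y) \<le> K*th*y1 + s*y2" .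
  have "K * cosh (dist Q Y) * ch - cosh (dist X Y) = K*th*y1 + s*y2"
  proof -
    have "K * cosh (dist Q Y) * ch - cosh (dist X Y) = K * (b + K*c) * (ch\<^sup>2 - 1) + (K\<^sup>2 - 1) * c"
      unfolding cq cXY by (simp add: power2_eq_square algebra_simps)
    also have "\<dots> = K * (b + K*c) * th\<^sup>2 + s\<^sup>2 * c" by (simp add: K(4,5))
    also have "\<dots> = K*th*y1 + s*y2" by (simp add: y1_def y2_def power2_eq_square)
    finally show ?thesis .
  qed
  then have "cosh (dist X Y) \<le> K * cosh (dist Q Y) * ch - (K*th) * sinh (dist Q Y)" using le by simp
  also have "\<dots> = K * cosh (dist Q Y - dist T Q)"
    unfolding cosh_diff ch_def[symmetric] th_def[symmetric] by (simp add: algebra_simps)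
  finally show ?thesis by (simp add: K_def)
qed

section \<open>Convex chains\<close>

lemma dist_le_path_length:
  fixes c :: "nat \<Rightarrow> 'a :: metric_space"
  shows "dist (c 0) (c j) \<le> (\<Sum>k<j. dist (c k) (c (Suc k)))"
proof (induction j)
  case (Suc j)
  then show ?case using dist_triangle[of "c 0" "c (Suc j)" "c j"] by simp
qed simp

text \<open>A convex chain inside a triangle, joining two of its vertices, is at most as long as the path over
  the third vertex \<open>p\<close>. The induction removes the last edge: the line of the edge before it, extended
  backwards, meets the segment from \<open>c 1\<close> to \<open>p\<close> in a point \<open>p'\<close>, which serves for the shorter chain; then
  the triangle inequality for \<open>p'\<close>, \<open>p\<close> and \<open>c (r - 1)\<close> is used.\<close>
lemma convex_chain_length:
  fixes c :: "nat \<Rightarrow> hyp_plane"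
  assumes "r \<ge> 2"
    and "\<And>i j k. i < j \<Longrightarrow> j < k \<Longrightarrow> k \<le> r \<Longrightarrow> tri (hvec (c i)) (hvec (c j)) (hvec (c k)) > 0"
    and "c 1 \<in> hseg (c 0) p" "c (r - 1) \<in> hseg p (c r)"
  shows "(\<Sum>k<r. dist (c k) (c (Suc k))) \<le> dist (c 0) p + dist p (c r)"
  using assms
proof (induction r arbitrary: p)
  case (Suc r)
  show ?case
  proof (cases "r = 1")
    case True
    then have "dist (c 0) p = dist (c 0) (c 1) + dist (c 1) p" "dist p (c 2) = dist p (c 1) + dist (c 1) (c 2)"
      using Suc.prems by (auto simp: hseg_def numeral_2_eq_2)
    then show ?thesis using True by (simp add: numeral_2_eq_2)
  next
    case False
    then have r: "r \<ge> 2" using Suc.prems by simp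
    note pos = Suc.prems(2)
    let ?c = "\<lambda>i. hvec (c i)" and ?p = "hvec p"
    obtain a b where ab: "a \<ge> 0" "b \<ge> 0" "?c 1 = a *\<^sub>R ?c 0 + b *\<^sub>R ?p" "c 1 \<noteq> c 0 \<Longrightarrow> b > 0"
      using hseg_imp_comb[OF Suc.prems(3)] by metis
    obtain a' b' where ab': "a' \<ge> 0" "b' \<ge> 0" "?c r = a' *\<^sub>R ?p + b' *\<^sub>R ?c (Suc r)" "c r \<noteq> c (Suc r) \<Longrightarrow> a' > 0"
      using hseg_imp_comb[OF Suc.prems(4)] by (metis diff_Suc_1)
    have "c 1 \<noteq> c 0" using pos[of 0 1 2] r by auto
    then have b: "b > 0" using ab by simp
    have "c r \<noteq> c (Suc r)" using pos[of 0 r "Suc r"] r by auto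
    then have a': "a' > 0" using ab' by simp
    define f where "f z = tri (?c (r-1)) (?c r) z" for z
    have f0: "f (?c 0) > 0" using pos[of 0 "r-1" r] r tri_rotate[of "?c 0" "?c (r-1)" "?c r"] by (simp add: f_def)
    have f1: "f (?c 1) \<ge> 0"
    proof (cases "r = 2")
      case False
      then have "1 < r - 1" using r by linarith
      then show ?thesis using pos[of 1 "r-1" r] r tri_rotate[of "?c 1" "?c (r-1)" "?c r"] by (simp add: f_def)
    qed (simp add: f_def)
    have "0 = f (?c r)" by (simp add: f_def)
    also have "\<dots> = a' * f ?p + b' * f (?c (Suc r))" by (subst ab'(3)) (simp add: f_def)
    finally have "0 = a' * f ?p + b' * f (?c (Suc r))" .
    moreover have "f (?c (Suc r)) > 0" using pos[of "r-1" r "Suc r"] r by (simp add: f_def)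
    then have "b' * f (?c (Suc r)) \<ge> 0" using ab'(2) by simp
    ultimately have "a' * f ?p \<le> 0" by linarith
    then have fp: "f ?p \<le> 0" using a' by (simp add: mult_le_0_iff)
    \<comment> \<open>The zero of \<open>f\<close> on the segment from \<open>c 1\<close> to \<open>p\<close>; if \<open>f\<close> vanishes on the whole segment, \<open>c 1\<close> will do.\<close>
    obtain p' where p': "p' \<in> hseg (c 1) p" "c (r - 1) \<in> hseg p' (c r)"
    proof (cases "f (?c 1) = 0 \<and> f ?p = 0")
      case True
      have "r = 2"
      proof (rule ccontr)
        assume "r \<noteq> 2"
        then have "1 < r - 1" using r by linarith
        then have "f (?c 1) > 0" using pos[of 1 "r-1" r] r tri_rotate[of "?c 1" "?c (r-1)" "?c r"] by (simp add: f_def)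
        then show False using True by simp
      qed
      then show ?thesis using that[of "c 1"] by simp
    next
      case False
      define u where "u = f (?c 1) *\<^sub>R ?p + (- f ?p) *\<^sub>R ?c 1"
      have "mink u u < 0" "u $ 3 > 0"
        using nonneg_comb_future[of "f (?c 1)" "- f ?p" 0 p "c 1" p] False f1 fp unfolding u_def by auto
      then obtain p' k where k: "k > 0" "hvec p' = k *\<^sub>R u" using future_normalise by blast
      have "p' \<in> hseg (c 1) p"
        using hseg_comb[of p' "k * - f ?p" "c 1" "k * f (?c 1)" p] k f1 fp
        by (simp add: u_def algebra_simps mult_nonneg_nonpos)
      moreover have "c (r-1) \<in> hseg p' (c r)"
      proof -
        have fu: "f (hvec p') = 0" by (simp add: f_def k u_def)
        define q where "q = k * (f (?c 1) / b - f ?p)"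
        have "f (?c 1) / b \<ge> 0" "f (?c 1) / b \<noteq> 0 \<or> f ?p \<noteq> 0" using False f1 b by auto
        then have "f (?c 1) / b - f ?p > 0" using fp by linarith
        then have "q > 0" using k(1) by (simp add: q_def)
        have tp: "b * tri ?p y z = tri (?c 1) y z - a * tri (?c 0) y z" for y z
          using arg_cong[OF ab(3), of "\<lambda>v. tri v y z"] by simp
        define e0 e1 where "e0 = tri (?c 0) (?c 1) (?c r)" and "e1 = tri (?c 0) (?c 1) (?c (r-1))"
        have e0: "e0 > 0" using pos[of 0 1 r] r by (simp add: e0_def)
        have e1: "e1 \<ge> 0"
        proof (cases "r = 2")
          case False
          then have "1 < r - 1" "r - 1 \<le> Suc r" using r by linarith+
          then show ?thesis using pos[of 0 1 "r-1"] r by (simp add: e1_def)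
        qed (simp add: e1_def)
        have "tri (?c 1) (?c r) (?c 0) = e0" by (simp add: e0_def flip: tri_rotate[of "?c 0"])
        moreover from this have "tri ?p (?c r) (?c 0) = e0 / b"
          using tp[of "?c r" "?c 0"] b by (simp add: field_simps)
        ultimately have 1: "tri (hvec p') (?c r) (?c 0) = q * e0"
          by (simp add: k(2) u_def q_def algebra_simps)
        have "tri (?c (r-1)) (?c 1) (?c 0) = - e1"
          using tri_reverse[of "?c (r-1)" "?c 1" "?c 0"] by (simp add: e1_def)
        moreover have "tri (?c (r-1)) ?p (?c 0) = - e1 / b"
          using tp[of "?c 0" "?c (r-1)"] tri_swap[of "?c 0" "?c 1" "?c (r-1)"] b
            tri_rotate[of "?c (r-1)" ?p "?c 0"] by (simp add: field_simps e1_def)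
        ultimately have 2: "tri (?c (r-1)) (hvec p') (?c 0) = - q * e1"
          by (simp add: k(2) u_def q_def algebra_simps)
        have "f (?c 0) *\<^sub>R hvec p' = (q * e0) *\<^sub>R ?c (r-1) + (- q * e1) *\<^sub>R ?c r"
          using tri_cramer[of "?c (r-1)" "?c r" "?c 0" "hvec p'"] 1 2 fu by (simp add: f_def)
        then have "(q * e0) *\<^sub>R ?c (r-1) = f (?c 0) *\<^sub>R hvec p' + (q * e1) *\<^sub>R ?c r" by (simp add: algebra_simps)
        then have "(1 / (q*e0)) *\<^sub>R ((q * e0) *\<^sub>R ?c (r-1)) = (1 / (q*e0)) *\<^sub>R (f (?c 0) *\<^sub>R hvec p' + (q * e1) *\<^sub>R ?c r)" by simp
        then have "?c (r-1) = (f (?c 0) / (q*e0)) *\<^sub>R hvec p' + (q*e1 / (q*e0)) *\<^sub>R ?c r"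
          using \<open>q > 0\<close> e0 by (simp add: scaleR_add_right)
        then show ?thesis using hseg_comb \<open>q > 0\<close> e0 e1 f0 by simp
      qed
      ultimately show ?thesis using that by blast
    qed
    have "(\<Sum>k<r. dist (c k) (c (Suc k))) \<le> dist (c 0) p' + dist p' (c r)"
      using Suc.IH[of p'] pos r p' hseg_extend(1)[OF Suc.prems(3) p'(1)] by simp
    moreover have "dist (c 0) p' + dist p' p = dist (c 0) p" using hseg_extend(2)[OF Suc.prems(3) p'(1)] .
    moreover have "dist p (c r) + dist (c r) (c (Suc r)) = dist p (c (Suc r))"
      using Suc.prems(4) by (simp add: hseg_def)
    ultimately show ?thesis using dist_triangle[of p' "c r" p] by simp
  qed
qed simp

section \<open>Two altitudes over a long chord\<close>

text \<open>The apex lies over the midpoint of the side, so it is a combination of \<open>X + Y\<close> and the normal of the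
  line \<open>X Y\<close>. The coefficients \<open>k\<close> and \<open>n\<close> are forced by the two distances and the norm.\<close>
lemma equilateral_apex:
  assumes "X \<noteq> Y"
  obtains E where "dist X E = dist X Y" "dist Y E = dist X Y" "tri (hvec X) (hvec Y) (hvec E) > 0"
proof -
  define C where "C = cosh (dist X Y)"
  have C: "C > 1" unfolding C_def using assms cosh_real_ge_1[of "dist X Y"] cosh_real_one_iff[of "dist X Y"] by (auto simp: less_le)
  define e where "e = lcross (hvec X) (hvec Y)"
  define Q where "Q = C\<^sup>2 - 1"
  have Q: "Q > 0" using C by (simp add: Q_def one_less_power)
  have e0: "mink e (hvec X) = 0" "mink e (hvec Y) = 0" "mink (hvec X) e = 0" "mink (hvec Y) e = 0"
    using mink_commute[of _ e] by (simp_all add: e_def mink_lcross)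
  have ee: "mink e e = Q" by (simp add: e_def mink_lcross_self mink_hvec_self mink_hvec C_def Q_def)
  define k n where "k = C / (1 + C)" and "n = sqrt ((2*C+1) * (C-1) / ((1+C)*(Q)))"
  have n: "n > 0" "n\<^sup>2 * Q = (2*C+1)*(C-1)/(1+C)" using C Q by (simp_all add: n_def)
  define u where "u = k *\<^sub>R (hvec X + hvec Y) + n *\<^sub>R e"
  have uX: "mink u (hvec X) = - C" "mink u (hvec Y) = - C"
    using C by (simp_all add: u_def e0 mink_hvec dist_commute k_def divide_simps flip: C_def) (simp_all add: algebra_simps)
  have "mink u u = - (k\<^sup>2 * (2 + 2 * C)) + n\<^sup>2 * (Q)"
    by (simp add: u_def e0 ee mink_hvec dist_commute power2_eq_square algebra_simps flip: C_def)
  also have "\<dots> = -1" unfolding n using C by (simp add: k_def power2_eq_square divide_simps) (simp add: algebra_simps)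
  finally have uu: "mink u u = -1" .
  then have "u $ 3 > 0" using future_of_neg[of u X] uX C by simp
  then obtain E where E: "hvec E = u" using hvec_eqI uu by blast
  have "cosh (dist X E) = C" "cosh (dist Y E) = C" using uX by (simp_all add: cosh_dist E mink_commute)
  then have "dist X E = dist X Y" "dist Y E = dist X Y"
    unfolding C_def using cosh_real_nonneg_le_iff[of "dist X E" "dist X Y"] cosh_real_nonneg_le_iff[of "dist X Y" "dist X E"]
      cosh_real_nonneg_le_iff[of "dist Y E" "dist X Y"] cosh_real_nonneg_le_iff[of "dist X Y" "dist Y E"] by auto
  moreover have "tri (hvec X) (hvec Y) (hvec E) = n * (Q)"
    by (simp add: E u_def mink_lcross[symmetric] e0 ee flip: e_def)
  moreover have "n * (Q) > 0" using n(1) Q by (rule mult_pos_pos)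
  ultimately show ?thesis using that by simp
qed

text \<open>The numbers \<open>a, b, e\<close> are the coordinates of a point with respect to an equilateral triangle whose
  side \<open>d\<close> has \<open>cosh d = C\<close>, and \<open>K\<close> is the hyperbolic cosine of its distance from the first vertex. By
  the last assumption \<open>K\<close> does not exceed the hyperbolic cosine \<open>C / cosh (d/2)\<close> of the height. So the
  point cannot lie beyond the line of the side opposite to the first vertex. Algebraically, for fixed
  \<open>a\<close> and \<open>b + e\<close> the left-hand side of the first assumption is largest for \<open>b = e\<close>, and there it is
  less than \<open>1\<close> if \<open>a < 0\<close>.\<close>
lemma equilateral_coordinate_nonneg:
  fixes a b e C K :: real
  assumes one: "a\<^sup>2 + b\<^sup>2 + e\<^sup>2 + 2*C*(a*b + a*e + b*e) = 1" and K: "a + C*(b+e) = K" "K > 1" and C: "C \<ge> 1"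
    and big: "K\<^sup>2 * (C+1) \<le> 2 * C\<^sup>2"
  shows "a \<ge> 0"
proof (rule ccontr)
  assume "\<not> a \<ge> 0"
  then have a: "a < 0" by simp
  define u where "u = b + e"
  have u: "C * u = K - a" using K by (simp add: u_def)
  have "(C-1) * (4 * (b * e)) \<le> (C-1) * u\<^sup>2" using C
    using sum_squares_bound[of b e] by (intro mult_left_mono) (auto simp: u_def power2_sum)
  then have "2 \<le> 2*a\<^sup>2 + 4*C*a*u + (C+1)*u\<^sup>2"
    using one by (simp add: u_def power2_eq_square algebra_simps)
  then have "C\<^sup>2 * 2 \<le> C\<^sup>2 * (2*a\<^sup>2 + 4*C*a*u + (C+1)*u\<^sup>2)" by (intro mult_left_mono) auto
  also have "\<dots> = C\<^sup>2 * (2*a\<^sup>2 + 4*a*(K-a)) + (C+1)*(K-a)\<^sup>2" unfolding u[symmetric] by algebra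
  finally have 1: "C\<^sup>2 * 2 \<le> C\<^sup>2 * (2*a\<^sup>2 + 4*a*(K-a)) + (C+1)*(K-a)\<^sup>2" .
  have "K\<^sup>2 * ((C+1)*(K-a)\<^sup>2) \<le> 2 * C\<^sup>2 * (K-a)\<^sup>2" using mult_right_mono[OF big, of "(K-a)\<^sup>2"] by (simp add: algebra_simps)
  moreover have "K\<^sup>2 * (C\<^sup>2 * 2) \<le> K\<^sup>2 * (C\<^sup>2 * (2*a\<^sup>2 + 4*a*(K-a)) + (C+1)*(K-a)\<^sup>2)" using 1 by (intro mult_left_mono) auto
  ultimately have "C\<^sup>2 * 2 * K\<^sup>2 \<le> C\<^sup>2 * 2 * (K\<^sup>2 * (a\<^sup>2 + 2*a*(K-a)) + (K-a)\<^sup>2)" by (simp add: algebra_simps)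
  then have "K\<^sup>2 \<le> K\<^sup>2 * (a\<^sup>2 + 2*a*(K-a)) + (K-a)\<^sup>2" using C by (subst (asm) mult_le_cancel_left_pos) auto
  also have "\<dots> = K\<^sup>2 - (K\<^sup>2-1) * a\<^sup>2 + 2*a*K*(K\<^sup>2-1)" by algebra
  finally have "(K\<^sup>2-1) * a\<^sup>2 \<le> 2*a*K*(K\<^sup>2-1)" by simp
  moreover have "K\<^sup>2 - 1 > 0" using K by (simp add: one_less_power)
  moreover have "2*a*K*(K\<^sup>2-1) < 0" using a K \<open>K\<^sup>2 - 1 > 0\<close> by (simp add: mult_neg_pos)
  ultimately show False by (smt (verit) mult_nonneg_nonneg zero_le_power2)
qed

text \<open>Projective coordinates with respect to the triangle \<open>X Y E\<close>. The triples \<open>A1, A2, A3\<close> and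
  \<open>B1, B2, B3\<close> are two lines, \<open>(a1, b1, 1)\<close> and \<open>(a2, b2, 1)\<close> are a point on the first and a point on the
  second line, and \<open>(ox, oy, oe)\<close> is the intersection point. It lies in the triangle, and the last two
  inequalities tell on which side of the two given points it lies on the two lines.\<close>
lemma meeting_point_coordinates:
  fixes A1 A2 A3 B1 B2 B3 a1 b1 a2 b2 :: real
  assumes A: "A1 > 0" "A2 \<ge> 0" and B: "B1 \<ge> 0" "B2 > 0"
    and T1: "A1*a1 + A2*b1 + A3 = 0" "B1*a1 + B2*b1 + B3 > 0"
    and T2: "B1*a2 + B2*b2 + B3 = 0" "A1*a2 + A2*b2 + A3 > 0"
    and o: "0 \<le> a1" "a1 < a2" "0 \<le> b2" "b2 < b1"
  defines "ox \<equiv> A2*B3 - A3*B2" and "oy \<equiv> A3*B1 - A1*B3" and "oe \<equiv> A1*B2 - A2*B1"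
  shows "oe > 0" "ox \<ge> 0" "oy \<ge> 0" "oy < b1 * oe" "ox < a2 * oe"
proof -
  define p q where "p = a2 - a1" and "q = b1 - b2"
  have pq: "p > 0" "q > 0" using o by (auto simp: p_def q_def)
  have 1: "A2 * q < A1 * p" using T1 T2 by (simp add: p_def q_def algebra_simps)
  have 2: "B1 * p < B2 * q" using T1 T2 by (simp add: p_def q_def algebra_simps)
  have "(A2 * q) * (B1 * p) < (A1 * p) * (B2 * q)"
    using mult_strict_mono'[OF 1 2] A B pq by simp
  then have "(A2 * B1) * (p*q) < (A1 * B2) * (p*q)" by (simp add: algebra_simps)
  then show oe: "oe > 0" using pq by (simp add: oe_def)
  have A3e: "A3 = - (A1*a1 + A2*b1)" and B3e: "B3 = - (B1*a2 + B2*b2)" using T1 T2 by auto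
  have "ox = a1 * oe + A2 * (B2 * q - B1 * p)" unfolding ox_def oe_def A3e B3e p_def q_def by (simp add: algebra_simps)
  then show "ox \<ge> 0" using o oe 2 A by simp
  have "oy = b2 * oe + B1 * (A1 * p - A2 * q)" unfolding oy_def oe_def A3e B3e p_def q_def by (simp add: algebra_simps)
  then show "oy \<ge> 0" using o oe 1 B by simp
  have "b1 * oe - oy = A1 * (B2 * q - B1 * p)" unfolding oy_def oe_def A3e B3e p_def q_def by (simp add: algebra_simps)
  then show "oy < b1 * oe" using mult_pos_pos[OF A(1), of "B2 * q - B1 * p"] 2 by linarith
  have "a2 * oe - ox = B2 * (A1 * p - A2 * q)" unfolding ox_def oe_def A3e B3e p_def q_def by (simp add: algebra_simps)
  then show "ox < a2 * oe" using mult_pos_pos[OF B(2), of "A1 * p - A2 * q"] 1 by linarith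
qed

text \<open>One half of the configuration in \<open>crossing_altitudes\<close>. The altitude from \<open>X\<close> has the foot \<open>T\<close> on the
  side from \<open>c0\<close> to \<open>c1\<close>, and the line of this side meets another line, through \<open>d0\<close> and \<open>d1\<close>, in \<open>Q\<close>. The
  lemma \<open>hinge\<close> gives \<open>cosh d \<le> cosh w * cosh (r - t)\<close> with \<open>d = dist X Y\<close>, \<open>r = dist Q Y \<le> d\<close>,
  \<open>t = dist T Q\<close> and \<open>w = dist X T\<close>. As \<open>cosh w * cosh (d/2) \<le> cosh d\<close>, the numbers \<open>r\<close> and \<open>t\<close> differ by
  at least \<open>d/2\<close>, and \<open>cosh w * cosh t = cosh (dist X Q) \<le> cosh d\<close> excludes \<open>t > r\<close>. So \<open>t \<le> r - d/2 \<le> d/2\<close>.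

  The sign \<open>\<sigma>\<close> allows the use for both halves, which are mirror images of each other.\<close>
lemma altitude_foot_near_meeting_point:
  fixes X Y Q T c0 c1 d0 d1 :: hyp_plane and \<sigma> t0 t1 :: real
  assumes T: "hvec T = t0 *\<^sub>R hvec c0 + t1 *\<^sub>R hvec c1" "t0 > 0" "t1 > 0"
    and AX: "\<sigma> * tri (hvec c0) (hvec c1) (hvec X) > 0" and AY: "\<sigma> * tri (hvec c0) (hvec c1) (hvec Y) \<ge> 0"
    and AQ: "tri (hvec c0) (hvec c1) (hvec Q) = 0"
    and XTQ: "\<sigma> * tri (hvec X) (hvec T) (hvec Q) > 0"
    and XYQ: "\<sigma> * tri (hvec X) (hvec Y) (hvec Q) > 0"
    and B: "\<sigma> * tri (hvec d0) (hvec d1) (hvec c0) > 0" "\<sigma> * tri (hvec d0) (hvec d1) (hvec c1) \<ge> 0"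
      "tri (hvec d0) (hvec d1) (hvec Q) = 0"
    and right: "cosh (dist X c0) = cosh (dist X T) * cosh (dist T c0)" "cosh (dist X c1) = cosh (dist X T) * cosh (dist T c1)"
    and D: "dist X Q \<le> dist X Y" "dist Y Q \<le> dist X Y" and "X \<noteq> T"
    and big: "cosh (dist X T) * cosh (dist X Y / 2) \<le> cosh (dist X Y)"
  shows "c1 \<in> hseg c0 Q" "T \<in> hseg c0 Q" "dist T Q \<le> dist X Y / 2"
    "cosh (dist X T) * cosh (dist X Y / 2) < cosh (dist X Y) \<Longrightarrow> dist T Q < dist X Y / 2"
proof -
  define a p q where "a = \<sigma> * tri (hvec c0) (hvec c1) (hvec X)" and "p = \<sigma> * tri (hvec X) (hvec c0) (hvec Q)"
    and "q = \<sigma> * tri (hvec Q) (hvec c1) (hvec X)"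
  have a: "a > 0" using AX by (simp add: a_def)
  have "tri (hvec c0) (hvec c1) (hvec X) *\<^sub>R hvec Q = tri (hvec Q) (hvec c1) (hvec X) *\<^sub>R hvec c0 + tri (hvec X) (hvec c0) (hvec Q) *\<^sub>R hvec c1"
    using tri_cramer[of "hvec c0" "hvec c1" "hvec X" "hvec Q"] AQ tri_rotate[of "hvec X" "hvec c0" "hvec Q"] by simp
  from arg_cong[OF this, of "\<lambda>v. \<sigma> *\<^sub>R v"]
  have aQ: "a *\<^sub>R hvec Q = q *\<^sub>R hvec c0 + p *\<^sub>R hvec c1" by (simp add: a_def p_def q_def scaleR_add_right)
  have pq: "t0 * p - t1 * q > 0"
    using XTQ tri_reverse[of "hvec X" "hvec c1" "hvec Q"] by (simp add: T p_def q_def algebra_simps)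
  define b0 b1 where "b0 = \<sigma> * tri (hvec d0) (hvec d1) (hvec c0)" and "b1 = \<sigma> * tri (hvec d0) (hvec d1) (hvec c1)"
  have b: "b0 > 0" "b1 \<ge> 0" using B by (simp_all add: b0_def b1_def)
  have "q * b0 + p * b1 = \<sigma> * tri (hvec d0) (hvec d1) (a *\<^sub>R hvec Q)"
    by (simp only: aQ) (simp add: b0_def b1_def algebra_simps)
  then have qb: "q * b0 + p * b1 = 0" using B(3) by simp
  \<comment> \<open>Since the functional of the second line is positive at \<open>c0\<close> and nonnegative at \<open>c1\<close>, the coefficients \<open>p\<close>\<close>
  \<comment> \<open>and \<open>q\<close> of \<open>Q\<close> are not both positive, so \<open>Q\<close> is not between \<open>c0\<close> and \<open>c1\<close>. By the orientation of \<open>X, T, Q\<close>\<close>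
  \<comment> \<open>it lies on the same side of \<open>T\<close> as \<open>c1\<close>, hence beyond or at \<open>c1\<close>.\<close>
  have p: "p > 0"
  proof (rule ccontr)
    assume np: "\<not> p > 0"
    then have "p * b1 \<le> 0" using b by (simp add: mult_nonpos_nonneg)
    then have "q * b0 \<ge> 0" using qb by linarith
    then have "q \<ge> 0" using b by (simp add: zero_le_mult_iff)
    then have "t1 * q \<ge> 0" "t0 * p \<le> 0" using T np by (simp_all add: mult_nonneg_nonpos)
    then show False using pq by linarith
  qed
  have "p * b1 \<ge> 0" using p b by simp
  then have "q * b0 \<le> 0" using qb by linarith
  then have q: "q \<le> 0" using b by (simp add: mult_le_0_iff)
  have "(1/p) *\<^sub>R (p *\<^sub>R hvec c1) = (1/p) *\<^sub>R (a *\<^sub>R hvec Q - q *\<^sub>R hvec c0)" by (simp add: aQ)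
  then have "hvec c1 = (- q / p) *\<^sub>R hvec c0 + (a / p) *\<^sub>R hvec Q"
    using p by (simp add: scaleR_diff_right)
  from hseg_comb[OF this] show c1: "c1 \<in> hseg c0 Q" using a p q by (simp add: divide_nonpos_pos)
  moreover have "T \<in> hseg c0 c1" using hseg_comb[OF T(1)] T by simp
  ultimately show "T \<in> hseg c0 Q" by (rule hseg_trans)
  have rQ: "cosh (dist X Q) = cosh (dist X T) * cosh (dist T Q)"
  proof -
    have 1: "a * cosh (dist z Q) = q * cosh (dist z c0) + p * cosh (dist z c1)" for z
      using arg_cong[OF aQ, of "\<lambda>v. - mink (hvec z) v"] by (simp add: mink_hvec)
    have "a * cosh (dist X Q) = a * (cosh (dist X T) * cosh (dist T Q))"
      unfolding 1[of X] right using 1[of T] by algebra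
    then show ?thesis using a by simp
  qed
  define d where "d = \<sigma> * tri (hvec X) (hvec T) (hvec Q)"
  have d: "d > 0" using XTQ by (simp add: d_def)
  \<comment> \<open>The coordinates of \<open>Y\<close> along \<open>T\<close> and \<open>X\<close> with respect to \<open>Q, T, X\<close>, as \<open>hinge\<close> requires them.\<close>
  define yb yc where "yb = \<sigma> * tri (hvec X) (hvec Y) (hvec Q) / d" and "yc = - (\<sigma> * tri (hvec Q) (hvec T) (hvec Y)) / d"
  have yb: "yb \<ge> 0" using XYQ d by (simp add: yb_def)
  have "a * (\<sigma> * tri (hvec Q) (hvec T) (hvec Y)) = \<sigma> * tri (a *\<^sub>R hvec Q) (hvec T) (hvec Y)" by simp
  also have "\<dots> = (q * t1 - p * t0) * (\<sigma> * tri (hvec c0) (hvec c1) (hvec Y))"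
    unfolding aQ T(1) using tri_swap[of "hvec c1" "hvec c0" "hvec Y"] by (simp add: algebra_simps)
  also have "\<dots> \<le> 0" using AY p q T by (intro mult_nonpos_nonneg) (auto simp: mult_nonpos_nonneg intro: order_trans[of _ 0])
  finally have "\<sigma> * tri (hvec Q) (hvec T) (hvec Y) \<le> 0" using a by (simp add: mult_le_0_iff)
  then have yc: "yc \<ge> 0" using d by (simp add: yc_def divide_nonpos_pos)
  have "\<sigma> *\<^sub>R (tri (hvec Q) (hvec T) (hvec X) *\<^sub>R hvec Y) = \<sigma> *\<^sub>R (tri (hvec Y) (hvec T) (hvec X) *\<^sub>R hvec Q + tri (hvec Q) (hvec Y) (hvec X) *\<^sub>R hvec T
      + tri (hvec Q) (hvec T) (hvec Y) *\<^sub>R hvec X)"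
    using tri_cramer[of "hvec Q" "hvec T" "hvec X" "hvec Y"] by simp
  then have "- (d *\<^sub>R hvec Y) = (\<sigma> * tri (hvec Y) (hvec T) (hvec X)) *\<^sub>R hvec Q
      - (yb * d) *\<^sub>R hvec T - (yc * d) *\<^sub>R hvec X"
    using tri_reverse[of "hvec Q" "hvec T" "hvec X"] tri_reverse[of "hvec Q" "hvec Y" "hvec X"] d
    by (simp add: d_def[symmetric] yb_def yc_def scaleR_add_right) (simp add: d_def scaleR_diff_right)
  then have "(-1/d) *\<^sub>R (- (d *\<^sub>R hvec Y)) = (-1/d) *\<^sub>R ((\<sigma> * tri (hvec Y) (hvec T) (hvec X)) *\<^sub>R hvec Q
      - (yb * d) *\<^sub>R hvec T - (yc * d) *\<^sub>R hvec X)" by simp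
  then have Y: "hvec Y = (- (\<sigma> * tri (hvec Y) (hvec T) (hvec X)) / d) *\<^sub>R hvec Q + yb *\<^sub>R hvec T + yc *\<^sub>R hvec X"
    using d by (simp add: scaleR_diff_right)
  have "Q \<noteq> T" "Q \<noteq> Y" using XTQ XYQ by auto
  define K \<delta> \<tau> r where "K = cosh (dist X T)" and "\<delta> = dist X Y" and "\<tau> = dist T Q" and "r = dist Q Y"
  have K: "K > 0" by (simp add: K_def cosh_real_pos)
  have hi: "cosh \<delta> \<le> K * cosh (r - \<tau>)"
    using hinge[OF rQ Y yb yc] \<open>X \<noteq> T\<close> \<open>Q \<noteq> T\<close> by (simp add: K_def \<delta>_def \<tau>_def r_def)
  have nn: "\<delta> \<ge> 0" "\<tau> \<ge> 0" "r > 0" "r \<le> \<delta>" using \<open>Q \<noteq> Y\<close> D(2) by (auto simp: \<delta>_def \<tau>_def r_def dist_commute)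
  have cle: "cosh x \<le> cosh \<bar>y\<bar> \<Longrightarrow> x \<ge> 0 \<Longrightarrow> x \<le> \<bar>y\<bar>" for x y :: real using cosh_real_nonneg_le_iff[of x "\<bar>y\<bar>"] by simp
  have clt: "cosh x < cosh \<bar>y\<bar> \<Longrightarrow> x \<ge> 0 \<Longrightarrow> x < \<bar>y\<bar>" for x y :: real using cosh_real_nonneg_less_iff[of x "\<bar>y\<bar>"] by simp
  have "K * cosh \<tau> \<le> cosh \<delta>"
    using rQ D(1) by (simp add: K_def \<tau>_def \<delta>_def cosh_real_nonneg_le_iff flip: rQ)
  then have "K * cosh \<tau> \<le> K * cosh (r - \<tau>)" using hi by linarith
  then have "\<tau> \<le> \<bar>r - \<tau>\<bar>" using K cle[of \<tau> "r - \<tau>"] nn by simp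
  then have rt: "r \<ge> \<tau>" using nn by linarith
  have "K * cosh (\<delta>/2) \<le> K * cosh (r - \<tau>)" using hi big unfolding K_def \<delta>_def by linarith
  then have "\<delta>/2 \<le> \<bar>r - \<tau>\<bar>" using K cle[of "\<delta>/2" "r - \<tau>"] nn by simp
  then show "dist T Q \<le> dist X Y / 2" using rt nn unfolding \<tau>_def[symmetric] \<delta>_def[symmetric] by linarith
  assume "cosh (dist X T) * cosh (dist X Y / 2) < cosh (dist X Y)"
  then have "K * cosh (\<delta>/2) < K * cosh (r - \<tau>)" using hi unfolding K_def \<delta>_def by linarith
  then have "\<delta>/2 < \<bar>r - \<tau>\<bar>" using K clt[of "\<delta>/2" "r - \<tau>"] nn by simp
  then show "dist T Q < dist X Y / 2" using rt nn unfolding \<tau>_def[symmetric] \<delta>_def[symmetric] by linarith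
qed

text \<open>Both conditions compare \<open>K\<close> with the hyperbolic cosine \<open>cosh d / cosh (d/2)\<close> of the height of the
  equilateral triangle with side \<open>d\<close>; the second one is polynomial in \<open>cosh d\<close>.\<close>
lemma long_chord_polynomial:
  assumes "K * cosh (d/2) \<le> cosh (d::real)" "K > 0"
  shows "K\<^sup>2 * (cosh d + 1) \<le> 2 * (cosh d)\<^sup>2"
proof -
  have "cosh d = 2 * (cosh (d/2))\<^sup>2 - 1" using cosh_double_cosh[of "d/2"] by simp
  then have 1: "cosh d + 1 = 2 * (cosh (d/2))\<^sup>2" by simp
  have "(K * cosh (d/2))\<^sup>2 \<le> (cosh d)\<^sup>2" using assms by (intro power_mono) (auto simp: cosh_real_nonneg)
  then show ?thesis unfolding 1 by (simp add: power_mult_distrib)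
qed

text \<open>The points \<open>X, Y, c0, c1, c2, c3\<close> are vertices of a convex polygon in this cyclic order, where \<open>Y = c0\<close>,
  \<open>c1 = c2\<close> and \<open>c3 = X\<close> are allowed, and \<open>T1\<close>, \<open>T2\<close> are the feet of the altitudes from \<open>X\<close> and \<open>Y\<close>. Let \<open>E\<close> be the
  apex of the equilateral triangle over \<open>[X, Y]\<close>. Its height is at least \<open>w\<close>, so the feet \<open>T1\<close> and \<open>T2\<close>
  cannot lie beyond \<open>[Y, E]\<close> and \<open>[X, E]\<close>, respectively (lemma \<open>equilateral_coordinate_nonneg\<close>). With the order of
  \<open>X, Y, T1, T2\<close> this places the intersection point \<open>Q\<close> of the two side lines in the triangle \<open>X Y E\<close>.
  Hence \<open>Q\<close> has distance at most \<open>dist X Y\<close> from \<open>X\<close> and \<open>Y\<close>, as \<open>altitude_foot_near_meeting_point\<close> requires.\<close>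
lemma crossing_altitudes:
  fixes X Y T1 T2 c0 c1 c2 c3 :: hyp_plane and t0 t1 s0 s1 w :: real
  assumes T1: "hvec T1 = t0 *\<^sub>R hvec c0 + t1 *\<^sub>R hvec c1" "t0 > 0" "t1 > 0"
    and T2: "hvec T2 = s0 *\<^sub>R hvec c2 + s1 *\<^sub>R hvec c3" "s0 > 0" "s1 > 0"
    and o: "tri (hvec X) (hvec Y) (hvec T1) > 0" "tri (hvec X) (hvec Y) (hvec T2) > 0"
      "tri (hvec X) (hvec T1) (hvec T2) > 0" "tri (hvec Y) (hvec T1) (hvec T2) > 0"
    and A: "tri (hvec c0) (hvec c1) (hvec X) > 0" "tri (hvec c0) (hvec c1) (hvec Y) \<ge> 0"
      "tri (hvec c0) (hvec c1) (hvec T2) > 0" "tri (hvec c0) (hvec c1) (hvec c2) \<ge> 0" "tri (hvec c0) (hvec c1) (hvec c3) > 0"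
    and B: "tri (hvec c2) (hvec c3) (hvec X) \<ge> 0" "tri (hvec c2) (hvec c3) (hvec Y) > 0"
      "tri (hvec c2) (hvec c3) (hvec T1) > 0" "tri (hvec c2) (hvec c3) (hvec c0) > 0" "tri (hvec c2) (hvec c3) (hvec c1) \<ge> 0"
    and right: "cosh (dist X c0) = cosh (dist X T1) * cosh (dist T1 c0)" "cosh (dist X c1) = cosh (dist X T1) * cosh (dist T1 c1)"
      "cosh (dist Y c2) = cosh (dist Y T2) * cosh (dist T2 c2)" "cosh (dist Y c3) = cosh (dist Y T2) * cosh (dist T2 c3)"
    and w: "dist X T1 = w" "dist Y T2 = w" "w > 0"
    and big: "cosh w * cosh (dist X Y / 2) \<le> cosh (dist X Y)"
  obtains Q where "c1 \<in> hseg c0 Q" "T1 \<in> hseg c0 Q" "c2 \<in> hseg Q c3" "T2 \<in> hseg Q c3" "dist T1 Q + dist Q T2 \<le> dist X Y"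
    "cosh w * cosh (dist X Y / 2) < cosh (dist X Y) \<Longrightarrow> dist T1 Q + dist Q T2 < dist X Y"
proof -
  let ?X = "hvec X" and ?Y = "hvec Y"
  have "X \<noteq> Y" using o(1) by auto
  then obtain E where E: "dist X E = dist X Y" "dist Y E = dist X Y" "tri ?X ?Y (hvec E) > 0"
    by (rule equilateral_apex)
  let ?E = "hvec E"
  define \<Delta> C K where "\<Delta> = tri ?X ?Y ?E" and "C = cosh (dist X Y)" and "K = cosh w"
  have \<Delta>: "\<Delta> > 0" using E by (simp add: \<Delta>_def)
  have perm: "tri ?Y ?X ?E = - \<Delta>" "tri ?Y ?E ?X = \<Delta>" "tri ?X ?E ?Y = - \<Delta>"
    by (simp_all add: \<Delta>_def tri_expand algebra_simps)
  have K: "K > 1" using w(3) cosh_real_ge_1[of w] cosh_real_one_iff[of w] by (auto simp: K_def less_le)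
  have C: "C \<ge> 1" by (simp add: C_def cosh_real_ge_1)
  have big2: "K\<^sup>2 * (C + 1) \<le> 2 * C\<^sup>2" unfolding K_def C_def using big by (intro long_chord_polynomial) (auto simp: cosh_real_pos)
  have coords: "hvec z = (tri (hvec z) ?Y ?E / \<Delta>) *\<^sub>R ?X + (tri ?X (hvec z) ?E / \<Delta>) *\<^sub>R ?Y + (tri ?X ?Y (hvec z) / \<Delta>) *\<^sub>R ?E" for z
  proof -
    have "(1/\<Delta>) *\<^sub>R (\<Delta> *\<^sub>R hvec z) = (1/\<Delta>) *\<^sub>R (tri (hvec z) ?Y ?E *\<^sub>R ?X + tri ?X (hvec z) ?E *\<^sub>R ?Y + tri ?X ?Y (hvec z) *\<^sub>R ?E)"
      using tri_cramer[of ?X ?Y ?E "hvec z"] by (simp only: \<Delta>_def)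
    then show ?thesis using \<Delta> by (simp add: scaleR_add_right)
  qed
  \<comment> \<open>Norm and distances of a point with coordinates \<open>a, b, e\<close> in the basis \<open>X, Y, E\<close>.\<close>
  have unit: "a\<^sup>2 + b\<^sup>2 + e\<^sup>2 + 2*C*(a*b + a*e + b*e) = 1" "cosh (dist X z) = a + C * (b + e)" "cosh (dist Y z) = b + C * (a + e)"
    if "hvec z = a *\<^sub>R ?X + b *\<^sub>R ?Y + e *\<^sub>R ?E" for z a b e
    using mink_hvec_self[of z] E(1,2) unfolding cosh_dist[of X z] cosh_dist[of Y z] that
    by (simp_all add: mink_hvec dist_commute power2_eq_square algebra_simps flip: C_def)
  obtain a1 b1 e1 where t1: "hvec T1 = a1 *\<^sub>R ?X + b1 *\<^sub>R ?Y + e1 *\<^sub>R ?E" "e1 > 0"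
    using that coords[of T1] o(1) \<Delta> by (metis divide_pos_pos)
  obtain a2 b2 e2 where t2: "hvec T2 = a2 *\<^sub>R ?X + b2 *\<^sub>R ?Y + e2 *\<^sub>R ?E" "e2 > 0"
    using that coords[of T2] o(2) \<Delta> by (metis divide_pos_pos)
  have a1: "a1 \<ge> 0" using equilateral_coordinate_nonneg[OF _ _ K C big2, of a1 b1 e1] unit[OF t1(1)] w by (simp add: K_def)
  have b2: "b2 \<ge> 0" using equilateral_coordinate_nonneg[OF _ _ K C big2, of b2 a2 e2] unit[OF t2(1)] w by (simp add: K_def algebra_simps)
  have "tri ?X (hvec T1) (hvec T2) = (b1 * e2 - e1 * b2) * \<Delta>"
    unfolding t1 t2 by (simp add: perm algebra_simps flip: \<Delta>_def)
  then have b12: "e1 * b2 < b1 * e2" using o(3) \<Delta> by (simp add: zero_less_mult_iff)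
  have "tri ?Y (hvec T1) (hvec T2) = (e1 * a2 - a1 * e2) * \<Delta>"
    unfolding t1 t2 by (simp add: perm algebra_simps)
  then have a12: "a1 * e2 < e1 * a2" using o(4) \<Delta> by (simp add: zero_less_mult_iff)
  define A1 A2 A3 where "A1 = tri (hvec c0) (hvec c1) ?X" and "A2 = tri (hvec c0) (hvec c1) ?Y" and "A3 = tri (hvec c0) (hvec c1) ?E"
  define B1 B2 B3 where "B1 = tri (hvec c2) (hvec c3) ?X" and "B2 = tri (hvec c2) (hvec c3) ?Y" and "B3 = tri (hvec c2) (hvec c3) ?E"
  have "tri (hvec c0) (hvec c1) (hvec T1) = 0" by (simp add: T1)
  then have AT1: "A1 * a1 + A2 * b1 + A3 * e1 = 0" by (simp add: t1 A1_def A2_def A3_def algebra_simps)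
  have "tri (hvec c2) (hvec c3) (hvec T2) = 0" by (simp add: T2)
  then have BT2: "B1 * a2 + B2 * b2 + B3 * e2 = 0" by (simp add: t2 B1_def B2_def B3_def algebra_simps)
  have AT2: "A1 * a2 + A2 * b2 + A3 * e2 > 0" using A(3) by (simp add: t2 A1_def A2_def A3_def algebra_simps)
  have BT1: "B1 * a1 + B2 * b1 + B3 * e1 > 0" using B(3) by (simp add: t1 B1_def B2_def B3_def algebra_simps)
  have div: "u * (a / e) + v * (b / e) + z = (u * a + v * b + z * e) / e" if "e > 0" for u v z a b e :: real
    using that by (simp add: field_simps)
  define ox oy oe where "ox = A2*B3 - A3*B2" and "oy = A3*B1 - A1*B3" and "oe = A1*B2 - A2*B1"
  have ord: "0 \<le> a1/e1" "a1/e1 < a2/e2" "0 \<le> b2/e2" "b2/e2 < b1/e1"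
    using a1 b2 a12 b12 t1(2) t2(2) by (simp_all add: field_simps)
  have lin: "A1 * (a1/e1) + A2 * (b1/e1) + A3 = 0" "B1 * (a1/e1) + B2 * (b1/e1) + B3 > 0"
    "B1 * (a2/e2) + B2 * (b2/e2) + B3 = 0" "A1 * (a2/e2) + A2 * (b2/e2) + A3 > 0"
    unfolding div[OF t1(2)] div[OF t2(2)] using AT1 BT1 AT2 BT2 t1(2) t2(2) by simp_all
  have AB: "A1 > 0" "A2 \<ge> 0" "B1 \<ge> 0" "B2 > 0" using A B by (simp_all add: A1_def A2_def B1_def B2_def)
  note oo = meeting_point_coordinates[OF AB lin ord, folded ox_def oy_def oe_def]
  define u where "u = ox *\<^sub>R ?X + oy *\<^sub>R ?Y + oe *\<^sub>R ?E"
  have "mink u u < 0" "u $ 3 > 0" unfolding u_def using nonneg_comb_future[of ox oy oe X Y E] oo by linarith+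
  then obtain Q k where Q: "k > 0" "hvec Q = k *\<^sub>R u" using future_normalise by blast
  have AQ: "tri (hvec c0) (hvec c1) (hvec Q) = 0"
    unfolding Q u_def by (simp add: ox_def oy_def oe_def algebra_simps flip: A1_def A2_def A3_def)
  have BQ: "tri (hvec c2) (hvec c3) (hvec Q) = 0"
    unfolding Q u_def by (simp add: ox_def oy_def oe_def algebra_simps flip: B1_def B2_def B3_def)
  have XTQ: "tri ?X (hvec T1) (hvec Q) > 0"
  proof -
    have "tri ?X (hvec T1) (hvec Q) = k * \<Delta> * e1 * (b1 / e1 * oe - oy)"
      unfolding Q u_def t1 using t1(2) by (simp add: perm algebra_simps flip: \<Delta>_def)
    then show ?thesis using Q \<Delta> t1(2) oo by simp
  qed
  have YTQ: "- tri ?Y (hvec T2) (hvec Q) > 0"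
  proof -
    have "- tri ?Y (hvec T2) (hvec Q) = k * \<Delta> * e2 * (a2 / e2 * oe - ox)"
      unfolding Q u_def t2 using t2(2) by (simp add: perm algebra_simps)
    then show ?thesis using Q \<Delta> t2(2) oo by simp
  qed
  have XYQ: "tri ?X ?Y (hvec Q) > 0" using Q \<Delta> oo by (simp add: u_def flip: \<Delta>_def)
  have Qc: "hvec Q = (k * ox) *\<^sub>R ?X + (k * oy) *\<^sub>R ?Y + (k * oe) *\<^sub>R ?E" by (simp add: Q u_def scaleR_add_right)
  have dQ: "dist X Q \<le> dist X Y" "dist Y Q \<le> dist X Y"
    using dist_comb_le[OF Qc, of X "dist X Y"] dist_comb_le[OF Qc, of Y "dist X Y"] Q(1) oo E(1,2) by (simp_all add: dist_commute)
  then have dQ': "dist Y Q \<le> dist Y X" "dist X Q \<le> dist Y X" by (simp_all add: dist_commute)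
  have ne: "X \<noteq> T1" "Y \<noteq> T2" using w by auto
  \<comment> \<open>The signs for the two halves: \<open>\<sigma> = 1\<close> for \<open>X\<close>, and \<open>\<sigma> = -1\<close> for \<open>Y\<close> with the vertices in reverse order.\<close>
  have s1: "1 * tri (hvec c0) (hvec c1) ?X > 0" "1 * tri (hvec c0) (hvec c1) ?Y \<ge> 0"
    "1 * tri ?X (hvec T1) (hvec Q) > 0" "1 * tri ?X ?Y (hvec Q) > 0"
    "1 * tri (hvec c2) (hvec c3) (hvec c0) > 0" "1 * tri (hvec c2) (hvec c3) (hvec c1) \<ge> 0"
    using A B XTQ XYQ by simp_all
  have s2: "-1 * tri (hvec c3) (hvec c2) ?Y > 0" "-1 * tri (hvec c3) (hvec c2) ?X \<ge> 0"
    "-1 * tri ?Y (hvec T2) (hvec Q) > 0" "-1 * tri ?Y ?X (hvec Q) > 0"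
    "-1 * tri (hvec c1) (hvec c0) (hvec c3) > 0" "-1 * tri (hvec c1) (hvec c0) (hvec c2) \<ge> 0"
    "tri (hvec c3) (hvec c2) (hvec Q) = 0" "tri (hvec c1) (hvec c0) (hvec Q) = 0"
    using A B BQ XYQ YTQ AQ tri_swap[of "hvec c3" "hvec c2"] tri_swap[of "hvec c1" "hvec c0"] tri_swap[of ?Y ?X] by simp_all
  have T2': "hvec T2 = s1 *\<^sub>R hvec c3 + s0 *\<^sub>R hvec c2" by (simp add: T2)
  have big1: "cosh (dist X T1) * cosh (dist X Y / 2) \<le> cosh (dist X Y)"
    and big3: "cosh (dist Y T2) * cosh (dist Y X / 2) \<le> cosh (dist Y X)"
    using big w by (simp_all add: dist_commute)
  note h1 = altitude_foot_near_meeting_point[OF T1 s1(1,2) AQ s1(3,4,5,6) BQ right(1,2) dQ ne(1) big1]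
  note h2 = altitude_foot_near_meeting_point[OF T2' T2(3,2) s2(1,2) s2(7) s2(3,4,5,6) s2(8) right(4,3) dQ' ne(2) big3]
  show ?thesis
  proof (rule that[of Q])
    show "dist T1 Q + dist Q T2 \<le> dist X Y" using h1(3) h2(3) by (simp add: dist_commute)
    assume "cosh w * cosh (dist X Y / 2) < cosh (dist X Y)"
    then have "dist T1 Q < dist X Y / 2" "dist T2 Q < dist Y X / 2"
      using h1(4) h2(4) w by (simp_all add: dist_commute)
    then show "dist T1 Q + dist Q T2 < dist X Y" by (simp add: dist_commute)
  qed (use h1(1,2) h2(1,2) in \<open>auto simp: hseg_commute[of Q]\<close>)
qed

section \<open>Distances between vertices\<close>

text \<open>The metric content of an ordinary reduced polygon. The vertices are numbered by all natural numbers,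
  periodically with period \<open>2m + 1\<close>, so that no index has to be reduced and every side, diagonal and
  boundary chain starts at any chosen place.\<close>
locale reduced_polygon =
  fixes V :: "nat \<Rightarrow> hyp_plane" and m :: nat and w :: real
  assumes m: "m \<ge> 1" and w: "w > 0"
    and period: "V (k + (2 * m + 1)) = V k"
    and oriented: "\<lbrakk>a < b; b < c; c < a + (2 * m + 1)\<rbrakk> \<Longrightarrow> tri (hvec (V a)) (hvec (V b)) (hvec (V c)) > 0"
    and foot_ex: "\<exists>p. p \<in> hseg (V (k + m)) (V (k + m + 1)) - {V (k + m), V (k + m + 1)} \<and> dist (V k) p = w \<and>
      (\<forall>z \<in> {V (k + m), V (k + m + 1)}. cosh (dist (V k) z) = cosh (dist (V k) p) * cosh (dist p z))"
begin

text \<open>The weak form allows coinciding vertices, for which the determinant vanishes. This covers the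
  degenerate positions in \<open>crossing_altitudes\<close>.\<close>
lemma oriented_le:
  assumes "a \<le> b" "b \<le> c" "c \<le> a + (2 * m + 1)"
  shows "tri (hvec (V a)) (hvec (V b)) (hvec (V c)) \<ge> 0"
proof -
  consider "a = b" | "b = c" | "c = a + (2 * m + 1)" | "a < b" "b < c" "c < a + (2 * m + 1)"
    using assms by linarith
  then show ?thesis
  proof cases
    case 3
    then show ?thesis using period[of a] by simp
  qed (use oriented in \<open>auto intro: less_imp_le\<close>)
qed

definition foot :: "nat \<Rightarrow> hyp_plane" where
  "foot k = (SOME p. p \<in> hseg (V (k + m)) (V (k + m + 1)) - {V (k + m), V (k + m + 1)} \<and> dist (V k) p = w \<and>
      (\<forall>z \<in> {V (k + m), V (k + m + 1)}. cosh (dist (V k) z) = cosh (dist (V k) p) * cosh (dist p z)))"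

lemma foot_props:
  "foot k \<in> hseg (V (k + m)) (V (k + m + 1))" "foot k \<noteq> V (k + m)" "foot k \<noteq> V (k + m + 1)" "dist (V k) (foot k) = w"
  "cosh (dist (V k) (V (k + m))) = cosh (dist (V k) (foot k)) * cosh (dist (foot k) (V (k + m)))"
  "cosh (dist (V k) (V (k + m + 1))) = cosh (dist (V k) (foot k)) * cosh (dist (foot k) (V (k + m + 1)))"
  using someI_ex[OF foot_ex[of k], folded foot_def] by auto

text \<open>The second leg of the right triangle with hypotenuse \<open>[V k, V (k + m)]\<close> and first leg \<open>w\<close>; by
  congruence it is attached to this diagonal and not to one of its ends.\<close>
definition leg :: "nat \<Rightarrow> real" where "leg k = dist (foot k) (V (k + m))"

text \<open>The diagonal between \<open>V k\<close> and \<open>V (k + m + 1)\<close> is the one numbered \<open>k + m + 1\<close>, since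
  \<open>(k + m + 1) + m\<close> is \<open>k\<close> plus a full period. It is the hypotenuse of two right triangles with a leg \<open>w\<close>.\<close>
lemma leg_other: "dist (foot k) (V (k + m + 1)) = leg (k + m + 1)"
proof -
  have "k + m + 1 + m = k + (2 * m + 1)" by simp
  then have e: "V (k + m + 1 + m) = V k" by (simp only: period)
  have "cosh w * cosh (dist (foot k) (V (k + m + 1))) = cosh (dist (V k) (V (k + m + 1)))"
    using foot_props(4,6)[of k] by simp
  also have "\<dots> = cosh w * cosh (leg (k + m + 1))"
    using foot_props(4,5)[of "k + m + 1"] unfolding e leg_def by (simp add: dist_commute)
  finally show ?thesis unfolding leg_def using cosh_real_pos[of w] by (simp add: cosh_dist_eq_iff)
qed

lemma side_opposite: "dist (V (k + m)) (V (k + m + 1)) = leg k + leg (k + m + 1)"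
  using foot_props(1)[of k] leg_other[of k] by (simp add: hseg_def leg_def dist_commute)

lemma foot_period: "foot (k + (2 * m + 1)) = foot k"
proof -
  have "V (k + (2 * m + 1) + m) = V (k + m)" "V (k + (2 * m + 1) + m + 1) = V (k + m + 1)"
    using period[of "k + m"] period[of "k + m + 1"] by (simp_all only: ac_simps)
  then show ?thesis unfolding foot_def period by simp
qed

lemma leg_period: "leg (k + (2 * m + 1)) = leg k"
  using period[of "k + m"] unfolding leg_def foot_period by (simp only: ac_simps)

lemma side: "dist (V k) (V (k + 1)) = leg (k + m + 1) + leg (k + 1)"
proof -
  have "k + m + 1 + m = k + (2 * m + 1)" "k + m + 1 + m + 1 = k + 1 + (2 * m + 1)" by simp_all
  then have "V (k + m + 1 + m) = V k" "V (k + m + 1 + m + 1) = V (k + 1)" "leg (k + m + 1 + m + 1) = leg (k + 1)"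
    by (simp_all only: period leg_period)
  then show ?thesis using side_opposite[of "k + m + 1"] by simp
qed

text \<open>Every side is the sum of the legs of the two diagonals that join its ends to the opposite vertex. In
  the sums over a chain and over the opposite chain the same diagonals occur, except for the two
  extreme ones, which belong to the opposite chain only.\<close>
lemma opposite_chain_length:
  "(\<Sum>k<Suc j. dist (V (i + m + k)) (V (i + m + Suc k)))
     = leg i + (\<Sum>k<j. dist (V (i + k)) (V (i + Suc k))) + leg (i + j + m + 1)"
proof -
  have "(\<Sum>k<Suc j. dist (V (i + m + k)) (V (i + m + Suc k))) = (\<Sum>k<Suc j. leg (i + k)) + (\<Sum>k<Suc j. leg (i + k + m + 1))"
    unfolding sum.distrib[symmetric]
  proof (rule sum.cong)
    fix k show "dist (V (i + m + k)) (V (i + m + Suc k)) = leg (i + k) + leg (i + k + m + 1)"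
      using side_opposite[of "i + k"] by (simp add: ac_simps)
  qed simp
  also have "(\<Sum>k<Suc j. leg (i + k)) = leg i + (\<Sum>k<j. leg (i + Suc k))"
    by (subst sum.lessThan_Suc_shift) simp
  also have "(\<Sum>k<Suc j. leg (i + k + m + 1)) = (\<Sum>k<j. leg (i + k + m + 1)) + leg (i + j + m + 1)" by simp
  also have "leg i + (\<Sum>k<j. leg (i + Suc k)) + ((\<Sum>k<j. leg (i + k + m + 1)) + leg (i + j + m + 1))
    = leg i + ((\<Sum>k<j. leg (i + k + m + 1) + leg (i + k + 1))) + leg (i + j + m + 1)"
    by (simp add: sum.distrib)
  also have "(\<Sum>k<j. leg (i + k + m + 1) + leg (i + k + 1)) = (\<Sum>k<j. dist (V (i + k)) (V (i + Suc k)))"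
    using side[of "i + _"] by (intro sum.cong) (simp_all add: ac_simps)
  finally show ?thesis .
qed

text \<open>The assumption \<open>big\<close> means that the chord is at least as long as the side of the regular triangle of
  height \<open>w\<close>. The boundary path over the chord is as long as the one between the feet of the altitudes
  from its ends, and the latter is a convex chain in the triangle with the third vertex \<open>Q\<close> of
  \<open>crossing_altitudes\<close>. The lemma on convex chains is applied to full sides; the pieces between the feet
  and the next vertices are the two extreme legs in \<open>opposite_chain_length\<close>.\<close>
lemma long_chord:
  assumes j: "1 \<le> j" "j \<le> m" and big: "cosh w * cosh (dist (V i) (V (i + j)) / 2) \<le> cosh (dist (V i) (V (i + j)))"
  shows "(\<Sum>k<j. dist (V (i + k)) (V (i + Suc k))) \<le> dist (V i) (V (i + j))"
    "cosh w * cosh (dist (V i) (V (i + j)) / 2) < cosh (dist (V i) (V (i + j))) \<Longrightarrow>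
       (\<Sum>k<j. dist (V (i + k)) (V (i + Suc k))) < dist (V i) (V (i + j))"
proof -
  let ?h = "\<lambda>k. hvec (V k)" let ?n = "2 * m + 1"
  obtain t0 t1 where t: "hvec (foot i) = t0 *\<^sub>R ?h (i + m) + t1 *\<^sub>R ?h (i + m + 1)" "t0 > 0" "t1 > 0"
    using hseg_imp_comb[OF foot_props(1)[of i]] foot_props(2,3)[of i] by metis
  obtain s0 s1 where s: "hvec (foot (i + j)) = s0 *\<^sub>R ?h (i + j + m) + s1 *\<^sub>R ?h (i + j + m + 1)" "s0 > 0" "s1 > 0"
    using hseg_imp_comb[OF foot_props(1)[of "i + j"]] foot_props(2,3)[of "i + j"] by metis
  have X: "?h i = ?h (i + ?n)" and Y: "?h (i + j) = ?h (i + j + ?n)"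
    and C0: "?h (i + m) = ?h (i + m + ?n)" and C1: "?h (i + m + 1) = ?h (i + m + 1 + ?n)" by (simp_all only: period)
  have A: "tri (?h (i + m)) (?h (i + m + 1)) (?h i) > 0" "tri (?h (i + m)) (?h (i + m + 1)) (?h (i + j)) \<ge> 0"
    "tri (?h (i + m)) (?h (i + m + 1)) (?h (i + j + m)) \<ge> 0" "tri (?h (i + m)) (?h (i + m + 1)) (?h (i + j + m + 1)) > 0"
    unfolding X Y using j m by (auto intro!: oriented oriented_le)
  have B: "tri (?h (i + j + m)) (?h (i + j + m + 1)) (?h i) \<ge> 0" "tri (?h (i + j + m)) (?h (i + j + m + 1)) (?h (i + j)) > 0"
    "tri (?h (i + j + m)) (?h (i + j + m + 1)) (?h (i + m)) > 0" "tri (?h (i + j + m)) (?h (i + j + m + 1)) (?h (i + m + 1)) \<ge> 0"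
    unfolding X Y C0 C1 using j m by (auto intro!: oriented oriented_le)
  have AT: "tri (?h (i + m)) (?h (i + m + 1)) (hvec (foot (i + j))) > 0"
    unfolding s using A s by (simp add: add_nonneg_pos)
  have BT: "tri (?h (i + j + m)) (?h (i + j + m + 1)) (hvec (foot i)) > 0"
    unfolding t using B t by (simp add: add_pos_nonneg)
  have "tri (?h i) (?h (i + j)) (?h (i + m)) \<ge> 0" "tri (?h i) (?h (i + j)) (?h (i + m + 1)) > 0"
    using j m by (auto intro!: oriented oriented_le)
  then have XYT1: "tri (?h i) (?h (i + j)) (hvec (foot i)) > 0"
    unfolding t using t by (simp add: add_nonneg_pos)
  have "tri (?h i) (?h (i + j)) (?h (i + j + m)) > 0" "tri (?h i) (?h (i + j)) (?h (i + j + m + 1)) \<ge> 0"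
    using j m by (auto intro!: oriented oriented_le)
  then have XYT2: "tri (?h i) (?h (i + j)) (hvec (foot (i + j))) > 0"
    unfolding s using s by (simp add: add_pos_nonneg)
  have "tri (?h i) (?h (i + m)) (?h (i + j + m)) > 0" "tri (?h i) (?h (i + m)) (?h (i + j + m + 1)) \<ge> 0"
    "tri (?h i) (?h (i + m + 1)) (?h (i + j + m)) \<ge> 0" "tri (?h i) (?h (i + m + 1)) (?h (i + j + m + 1)) \<ge> 0"
    using j m by (auto intro!: oriented oriented_le)
  then have XTT: "tri (?h i) (hvec (foot i)) (hvec (foot (i + j))) > 0"
    unfolding s t using s t by (simp add: add_pos_nonneg distrib_left)
  have "tri (?h (i + j)) (?h (i + m)) (?h (i + j + m)) \<ge> 0" "tri (?h (i + j)) (?h (i + m)) (?h (i + j + m + 1)) \<ge> 0"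
    "tri (?h (i + j)) (?h (i + m + 1)) (?h (i + j + m)) \<ge> 0" "tri (?h (i + j)) (?h (i + m + 1)) (?h (i + j + m + 1)) > 0"
    using j m by (auto intro!: oriented oriented_le)
  then have YTT: "tri (?h (i + j)) (hvec (foot i)) (hvec (foot (i + j))) > 0"
    unfolding s t using s t by (simp add: add_nonneg_pos distrib_left)
  obtain Q where Q: "V (i + m + 1) \<in> hseg (V (i + m)) Q" "foot i \<in> hseg (V (i + m)) Q"
    "V (i + j + m) \<in> hseg Q (V (i + j + m + 1))" "foot (i + j) \<in> hseg Q (V (i + j + m + 1))"
    "dist (foot i) Q + dist Q (foot (i + j)) \<le> dist (V i) (V (i + j))"
    "cosh w * cosh (dist (V i) (V (i + j)) / 2) < cosh (dist (V i) (V (i + j))) \<Longrightarrow>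
      dist (foot i) Q + dist Q (foot (i + j)) < dist (V i) (V (i + j))"
    by (rule crossing_altitudes[OF t s XYT1 XYT2 XTT YTT A(1,2) AT A(3,4) B(1,2) BT B(3,4)
        foot_props(5,6)[of i] foot_props(5,6)[of "i + j"] foot_props(4) foot_props(4) w big]) (rule that)
  have "(\<Sum>k<Suc j. dist (V (i + m + k)) (V (i + m + Suc k))) \<le> dist (V (i + m + 0)) Q + dist Q (V (i + m + Suc j))"
  proof (rule convex_chain_length[of "Suc j" "\<lambda>k. V (i + m + k)"])
    show "V (i + m + 1) \<in> hseg (V (i + m + 0)) Q" using Q(1) by simp
    show "V (i + m + (Suc j - 1)) \<in> hseg Q (V (i + m + Suc j))" using Q(3) by (simp add: ac_simps)
  qed (use j m in \<open>auto intro!: oriented\<close>)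
  also have "dist (V (i + m + 0)) Q = leg i + dist (foot i) Q"
    using Q(2) by (simp add: hseg_def leg_def dist_commute)
  also have "dist Q (V (i + m + Suc j)) = dist Q (foot (i + j)) + leg (i + j + m + 1)"
    using Q(4) leg_other[of "i + j"] by (simp add: hseg_def ac_simps)
  finally have le: "(\<Sum>k<j. dist (V (i + k)) (V (i + Suc k))) \<le> dist (foot i) Q + dist Q (foot (i + j))"
    unfolding opposite_chain_length by simp
  show "(\<Sum>k<j. dist (V (i + k)) (V (i + Suc k))) \<le> dist (V i) (V (i + j))" using le Q(5) by linarith
  assume "cosh w * cosh (dist (V i) (V (i + j)) / 2) < cosh (dist (V i) (V (i + j)))"
  then show "(\<Sum>k<j. dist (V (i + k)) (V (i + Suc k))) < dist (V i) (V (i + j))" using le Q(6) by linarith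
qed

text \<open>Combines \<open>long_chord\<close> with the triangle inequality. In the case of equality a vertex strictly
  between the ends would lie on the chord, against the strict orientation of the vertices.\<close>
lemma chord_bound:
  assumes j: "1 \<le> j" "j \<le> m"
  shows "cosh (dist (V i) (V (i + j))) \<le> cosh w * cosh (dist (V i) (V (i + j)) / 2)"
    "cosh (dist (V i) (V (i + j))) = cosh w * cosh (dist (V i) (V (i + j)) / 2) \<Longrightarrow> j = 1"
proof -
  have path: "dist (V i) (V (i + j)) \<le> (\<Sum>k<j. dist (V (i + k)) (V (i + Suc k)))"
    using dist_le_path_length[of "\<lambda>k. V (i + k)" j] by simp
  then show "cosh (dist (V i) (V (i + j))) \<le> cosh w * cosh (dist (V i) (V (i + j)) / 2)"
    using long_chord[OF j, of i] by linarith
  assume eq: "cosh (dist (V i) (V (i + j))) = cosh w * cosh (dist (V i) (V (i + j)) / 2)"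
  show "j = 1"
  proof (rule ccontr)
    assume "j \<noteq> 1"
    define l where "l = j - 1"
    have l: "j = Suc l" using j by (simp add: l_def)
    have "dist (V (i + 1)) (V (i + j)) \<le> (\<Sum>k<l. dist (V (i + Suc k)) (V (i + Suc (Suc k))))"
      using dist_le_path_length[of "\<lambda>k. V (i + Suc k)" l] unfolding l by simp
    then have "dist (V i) (V (i + 1)) + dist (V (i + 1)) (V (i + j)) \<le> (\<Sum>k<j. dist (V (i + k)) (V (i + Suc k)))"
      unfolding l(1) sum.lessThan_Suc_shift by simp
    also have "\<dots> \<le> dist (V i) (V (i + j))" using long_chord(1)[OF j, of i] eq by simp
    finally have "V (i + 1) \<in> hseg (V i) (V (i + j))" using dist_triangle[of "V i" "V (i + j)" "V (i + 1)"] by (simp add: hseg_def)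
    then obtain a b where "hvec (V (i + 1)) = a *\<^sub>R hvec (V i) + b *\<^sub>R hvec (V (i + j))" using hseg_imp_comb by metis
    then have "tri (hvec (V i)) (hvec (V (i + 1))) (hvec (V (i + j))) = 0" by simp
    moreover have "tri (hvec (V i)) (hvec (V (i + 1))) (hvec (V (i + j))) > 0"
      using \<open>j \<noteq> 1\<close> j m by (intro oriented) auto
    ultimately show False by simp
  qed
qed

lemma vertex_distance_bound:
  assumes "p < q" "q < 2 * m + 1"
  shows "cosh (dist (V p) (V q)) \<le> cosh w * cosh (dist (V p) (V q) / 2)"
    "cosh (dist (V p) (V q)) = cosh w * cosh (dist (V p) (V q) / 2) \<Longrightarrow> q = p + 1 \<or> q = p + 2 * m"
proof -
  have *: "cosh (dist (V p) (V q)) \<le> cosh w * cosh (dist (V p) (V q) / 2) \<and>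
    (cosh (dist (V p) (V q)) = cosh w * cosh (dist (V p) (V q) / 2) \<longrightarrow> q = p + 1 \<or> q = p + 2 * m)"
  proof (cases "q - p \<le> m")
    case True
    define j where "j = q - p"
    have "1 \<le> j" "j \<le> m" "q = p + j" using True assms by (auto simp: j_def)
    then show ?thesis using chord_bound[of j p] by auto
  next
    case False
    define j where "j = 2 * m + 1 - (q - p)"
    have j: "1 \<le> j" "j \<le> m" "q + j = p + (2 * m + 1)" using False assms by (auto simp: j_def)
    \<comment> \<open>The shorter way around the polygon leads from \<open>q\<close> across index \<open>2m + 1\<close> back to \<open>p\<close>.\<close>
    have "V (q + j) = V p" unfolding j(3) by (rule period)
    then have e: "dist (V q) (V (q + j)) = dist (V p) (V q)" by (simp only: dist_commute)
    moreover have "j = 1 \<Longrightarrow> q = p + 2 * m" using j(3) by simp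
    ultimately show ?thesis using chord_bound[OF j(1,2), of q, unfolded e] by blast
  qed
  show "cosh (dist (V p) (V q)) \<le> cosh w * cosh (dist (V p) (V q) / 2)"
    "cosh (dist (V p) (V q)) = cosh w * cosh (dist (V p) (V q) / 2) \<Longrightarrow> q = p + 1 \<or> q = p + 2 * m" using * by auto
qed

end

text \<open>In an equilateral triangle the altitude bisects the side, because the two right triangles that it
  cuts off have equal hypotenuses.\<close>
lemma (in reduced_polygon) equilateral_side_half:
  assumes "m = 1" "dist (V 0) (V 1) = s" "dist (V 0) (V 2) = s" "dist (V 1) (V 2) = s"
  shows "cosh s = cosh w * cosh (s / 2)"
proof -
  have V: "V (0 + m) = V 1" "V (0 + m + 1) = V 2" using assms(1) by (simp_all add: numeral_2_eq_2)
  define f where "f = foot 0"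
  have 1: "cosh s = cosh w * cosh (dist f (V 1))" "cosh s = cosh w * cosh (dist f (V 2))"
    using foot_props(5,6)[of 0, unfolded V foot_props(4)] unfolding assms f_def by simp_all
  then have "cosh (dist f (V 1)) = cosh (dist f (V 2))" using cosh_real_pos[of w] by simp
  then have "dist f (V 1) = dist f (V 2)" by (simp only: cosh_dist_eq_iff)
  moreover have "s = dist f (V 1) + dist f (V 2)"
    using foot_props(1)[of 0, unfolded V] assms(4) by (simp add: f_def hseg_def dist_commute)
  ultimately have "s / 2 = dist f (V 1)" by simp
  then show ?thesis using 1(1) by (simp only:)
qed

section \<open>Jung's theorem\<close>

lemma sum_squares_weights_ge:
  fixes u :: "'a \<Rightarrow> real"
  assumes "finite T" "sum u T = 1" "card T \<le> 3"
  shows "(\<Sum>x\<in>T. (u x)\<^sup>2) \<ge> 1/3" "(\<Sum>x\<in>T. (u x)\<^sup>2) = 1/3 \<Longrightarrow> card T = 3 \<and> (\<forall>x\<in>T. u x = 1/3)"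
proof -
  have "(\<Sum>x\<in>T. (u x - 1/3)\<^sup>2) = (\<Sum>x\<in>T. (u x)\<^sup>2 - (2/3) * u x + 1/9)"
    by (intro sum.cong) (auto simp: power2_eq_square field_simps)
  also have "\<dots> = (\<Sum>x\<in>T. (u x)\<^sup>2) - 2/3 + card T / 9"
    by (simp only: sum.distrib sum_subtractf sum_distrib_left[symmetric] assms(2)) simp
  finally have e: "(\<Sum>x\<in>T. (u x - 1/3)\<^sup>2) = (\<Sum>x\<in>T. (u x)\<^sup>2) - 2/3 + card T / 9" .
  have c: "real (card T) \<le> 3" using assms(3) by simp
  have nn: "(\<Sum>x\<in>T. (u x - 1/3)\<^sup>2) \<ge> 0" by (intro sum_nonneg) auto
  then show "(\<Sum>x\<in>T. (u x)\<^sup>2) \<ge> 1/3" using e c by linarith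
  assume q: "(\<Sum>x\<in>T. (u x)\<^sup>2) = 1/3"
  have "real (card T) \<ge> 3" "(\<Sum>x\<in>T. (u x - 1/3)\<^sup>2) \<le> 0" using e c nn q by linarith+
  moreover from this(2) have "\<forall>x\<in>T. (u x - 1/3)\<^sup>2 = 0" using nn assms(1) by (subst (asm) order_antisym_conv) (auto simp: sum_nonneg_eq_0_iff)
  ultimately show "card T = 3 \<and> (\<forall>x\<in>T. u x = 1/3)" using c by auto
qed

lemma mink_sum: "mink (\<Sum>x\<in>T. g x) z = (\<Sum>x\<in>T. mink (g x) z)" "mink z (\<Sum>x\<in>T. g x) = (\<Sum>x\<in>T. mink z (g x))"
  by (induction T rule: infinite_finite_induct) (simp_all, simp_all add: mink_def)

lemma continuous_mink: "continuous_on A (\<lambda>y. - mink y y)"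
  unfolding mink_def by (intro continuous_intros)

text \<open>Jung's theorem with a description of the extremal case. Let \<open>y\<close> maximise \<open>f y = - mink y y\<close> on the
  convex hull of the points in \<open>real^3\<close>. Moving from \<open>y\<close> towards a point \<open>v\<close> of the set does not increase
  \<open>f\<close>, so \<open>- mink y (hvec v) \<le> f y\<close>: all points have distance at most \<open>r\<close> from the point on the ray of \<open>y\<close>, where
  \<open>(cosh r)\<^sup>2 = f y\<close>. The points that contribute to \<open>y\<close> give equality here and lie in a plane of
  \<open>real^3\<close>, so by Caratheodory three of them suffice. Expanding \<open>f y\<close> for a convex combination of three points
  with weights \<open>u\<close> gives \<open>f y \<le> M - (M - 1) * (\<Sum>x\<in>T. (u x)\<^sup>2) \<le> (1 + 2 * M) / 3\<close>, with equality only for equal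
  weights and distances.\<close>
lemma jung:
  fixes S :: "hyp_plane set" and M :: real
  assumes S: "finite S" "S \<noteq> {}" and M: "M > 1" "\<And>x y. x \<in> S \<Longrightarrow> y \<in> S \<Longrightarrow> cosh (dist x y) \<le> M"
  obtains c r where "r \<ge> 0" "\<And>x. x \<in> S \<Longrightarrow> dist c x \<le> r" "(cosh r)\<^sup>2 \<le> (1 + 2 * M) / 3"
    "(cosh r)\<^sup>2 = (1 + 2 * M) / 3 \<Longrightarrow>
      \<exists>x\<in>S. \<exists>y\<in>S. \<exists>z\<in>S. x \<noteq> y \<and> y \<noteq> z \<and> x \<noteq> z \<and> cosh (dist x y) = M \<and> cosh (dist y z) = M \<and> cosh (dist x z) = M"
proof -
  define f where "f y = - mink y y" for y :: "real^3"
  let ?H = "convex hull (hvec ` S)"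
  have "compact ?H" using S by (intro finite_imp_compact_convex_hull) auto
  moreover have "?H \<noteq> {}" using S by auto
  ultimately have "\<exists>y\<in>?H. \<forall>z\<in>?H. - mink z z \<le> - mink y y"
    by (rule continuous_attains_sup) (rule continuous_mink)
  then obtain y where y: "y \<in> ?H" "\<And>z. z \<in> ?H \<Longrightarrow> f z \<le> f y" unfolding f_def by blast
  have f1: "f y \<ge> 1"
  proof -
    obtain v where "v \<in> S" using S by auto
    then show ?thesis using y(2)[of "hvec v"] by (simp add: hull_inc f_def mink_hvec_self)
  qed
  have opt: "- mink y (hvec v) \<le> f y" if v: "v \<in> S" for v
  proof (rule ccontr)
    define g e where "g = - mink y (hvec v) - f y" and "e = f (hvec v - y)"
    assume "\<not> ?thesis"
    then have g: "g > 0" by (simp add: g_def)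
    define t where "t = min 1 (g / (\<bar>e\<bar> + 1))"
    have t: "0 < t" "t \<le> 1" "t \<le> g / (\<bar>e\<bar> + 1)" using g by (auto simp: t_def)
    have "(1 - t) *\<^sub>R y + t *\<^sub>R hvec v \<in> ?H"
      using y(1) v t by (intro convexD[OF convex_convex_hull]) (auto simp: hull_inc)
    from y(2)[OF this] have "2 * t * g + t\<^sup>2 * e \<le> 0"
      by (simp add: f_def g_def e_def mink_commute[of "hvec v" y] power2_eq_square algebra_simps)
    then have "t * (2 * g + t * e) \<le> 0" by (simp add: power2_eq_square algebra_simps)
    then have 1: "2 * g + t * e \<le> 0" using t by (simp add: mult_le_0_iff)
    have "t * \<bar>e\<bar> \<le> t * (\<bar>e\<bar> + 1)" using t by simp
    also have "\<dots> \<le> g" using t(3) by (simp add: pos_le_divide_eq)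
    finally have "t * \<bar>e\<bar> \<le> g" .
    moreover have "t * (- e) \<le> t * \<bar>e\<bar>" using t by (intro mult_left_mono) auto
    ultimately have "- g \<le> t * e" by simp
    then show False using 1 g by linarith
  qed
  define S' where "S' = {v \<in> S. - mink y (hvec v) = f y}"
  have yS': "y \<in> convex hull (hvec ` S')"
  proof -
    have fin: "finite (hvec ` S)" "finite (hvec ` S')" using S by (auto simp: S'_def)
    obtain u where u: "\<And>x. x \<in> hvec ` S \<Longrightarrow> 0 \<le> u x" "sum u (hvec ` S) = 1" "(\<Sum>x\<in>hvec ` S. u x *\<^sub>R x) = y"
      using y(1) unfolding convex_hull_finite[OF fin(1)] by auto
    have "(\<Sum>x\<in>hvec ` S. u x * (f y + mink y x)) = f y * sum u (hvec ` S) + mink y (\<Sum>x\<in>hvec ` S. u x *\<^sub>R x)"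
      by (simp add: mink_sum distrib_left sum.distrib sum_distrib_left mult.commute)
    also have "\<dots> = 0" unfolding u(2,3) by (simp add: f_def)
    finally have z: "(\<Sum>x\<in>hvec ` S. u x * (f y + mink y x)) = 0" .
    have nn: "u x * (f y + mink y x) \<ge> 0" if x: "x \<in> hvec ` S" for x
    proof -
      obtain v where "v \<in> S" "x = hvec v" using x by blast
      then show ?thesis using opt[of v] u(1)[OF x] by simp
    qed
    have "\<forall>x\<in>hvec ` S. u x * (f y + mink y x) = 0"
      using z nn fin(1) by (subst (asm) sum_nonneg_eq_0_iff) auto
    then have u0: "\<forall>x \<in> hvec ` S - hvec ` S'. u x = 0" unfolding S'_def by fastforce
    have sub: "hvec ` S' \<subseteq> hvec ` S" by (auto simp: S'_def)
    have "sum u (hvec ` S') = 1" unfolding u(2)[symmetric] using u0 by (intro sum.mono_neutral_left fin sub) auto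
    moreover have "(\<Sum>x\<in>hvec ` S'. u x *\<^sub>R x) = y" unfolding u(3)[symmetric] using u0 by (intro sum.mono_neutral_left fin sub) auto
    moreover have "\<forall>x\<in>hvec ` S'. 0 \<le> u x" using u(1) sub by auto
    ultimately show ?thesis unfolding convex_hull_finite[OF fin(2)] by (intro CollectI exI[of _ u] conjI)
  qed
  \<comment> \<open>The form \<open>mink y\<close> as a Euclidean inner product, so that the points of \<open>S'\<close> lie in a hyperplane.\<close>
  define a :: "real^3" where "a = vector [y$1, y$2, - y$3]"
  have ma: "mink y x = a \<bullet> x" for x by (simp add: mink_def a_def inner_vec_def sum_3)
  have "a \<noteq> 0"
  proof
    assume "a = 0"
    then have "mink y y = 0" by (simp add: ma)
    then show False using f1 by (simp add: f_def)
  qed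
  have "aff_dim (hvec ` S') \<le> aff_dim {x. a \<bullet> x = - f y}"
    by (intro aff_dim_subset) (auto simp: S'_def ma[symmetric])
  also have "\<dots> = 2" using aff_dim_hyperplane[OF \<open>a \<noteq> 0\<close>] by simp
  finally have ad: "aff_dim (hvec ` S') \<le> 2" .
  obtain T where T: "finite T" "T \<subseteq> hvec ` S'" "int (card T) \<le> aff_dim (hvec ` S') + 1" "y \<in> convex hull T"
    using yS' unfolding caratheodory_aff_dim[of "hvec ` S'"] by blast
  have cT: "card T \<le> 3" using T(3) ad by simp
  obtain u where u: "\<And>x. x \<in> T \<Longrightarrow> 0 \<le> u x" "sum u T = 1" "(\<Sum>x\<in>T. u x *\<^sub>R x) = y"
    using T(4) unfolding convex_hull_finite[OF T(1)] by auto
  \<comment> \<open>The largest possible Gram matrix.\<close>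
  define g where "g x x' = (if x = x' then 1 else M)" for x x' :: "real^3"
  have gm: "- mink x x' \<le> g x x'" if x: "x \<in> T" "x' \<in> T" for x x'
  proof -
    obtain v v' where "v \<in> S" "v' \<in> S" "x = hvec v" "x' = hvec v'" using x T(2) unfolding S'_def by blast
    then show ?thesis using M(2)[of v v'] by (auto simp: g_def mink_hvec hvec_inject)
  qed
  define U where "U = (\<Sum>x\<in>T. (u x)\<^sup>2)"
  have fy: "f y = (\<Sum>x\<in>T. \<Sum>x'\<in>T. u x * u x' * (- mink x x'))"
    unfolding f_def u(3)[symmetric] by (simp add: mink_sum sum_distrib_left sum_negf ac_simps) (simp add: mink_commute)
  have gU: "(\<Sum>x\<in>T. \<Sum>x'\<in>T. u x * u x' * g x x') = M - (M - 1) * U"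
  proof -
    have "(\<Sum>x'\<in>T. u x * u x' * g x x') = M * u x - (M - 1) * (u x)\<^sup>2" if x: "x \<in> T" for x
    proof -
      have "(\<Sum>x'\<in>T. u x * u x' * g x x') = (\<Sum>x'\<in>T. M * u x * u x' - (if x' = x then (M - 1) * (u x)\<^sup>2 else 0))"
        by (intro sum.cong) (auto simp: g_def power2_eq_square algebra_simps)
      also have "\<dots> = M * u x * sum u T - (M - 1) * (u x)\<^sup>2"
        using x T(1) by (simp add: sum_subtractf sum_distrib_left)
      finally show ?thesis using u(2) by simp
    qed
    then have "(\<Sum>x\<in>T. \<Sum>x'\<in>T. u x * u x' * g x x') = (\<Sum>x\<in>T. M * u x - (M - 1) * (u x)\<^sup>2)" by simp
    also have "\<dots> = M * sum u T - (M - 1) * U" by (simp add: U_def sum_subtractf sum_distrib_left)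
    finally show ?thesis using u(2) by simp
  qed
  have diff: "(\<Sum>x\<in>T. \<Sum>x'\<in>T. u x * u x' * (g x x' + mink x x')) = M - (M - 1) * U - f y"
    unfolding gU[symmetric] fy by (simp add: distrib_left sum.distrib sum_negf)
  have nn: "u x * u x' * (g x x' + mink x x') \<ge> 0" if "x \<in> T" "x' \<in> T" for x x'
    using gm[OF that] u(1) that by (intro mult_nonneg_nonneg) auto
  then have "0 \<le> M - (M - 1) * U - f y" unfolding diff[symmetric] by (intro sum_nonneg) auto
  moreover have U3: "U \<ge> 1/3" unfolding U_def using sum_squares_weights_ge(1)[OF T(1) u(2) cT] .
  then have "(M - 1) * U \<ge> (M - 1) * (1/3)" using M by (intro mult_left_mono) auto
  ultimately have le: "f y \<le> (1 + 2 * M) / 3" by (simp add: field_simps)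
  have eqc: "\<exists>x\<in>S. \<exists>y\<in>S. \<exists>z\<in>S. x \<noteq> y \<and> y \<noteq> z \<and> x \<noteq> z \<and> cosh (dist x y) = M \<and> cosh (dist y z) = M \<and> cosh (dist x z) = M"
    if eq: "f y = (1 + 2 * M) / 3"
  proof -
    have "(M - 1) * U \<le> (M - 1) * (1/3)" using \<open>0 \<le> M - (M - 1) * U - f y\<close> eq by (simp add: field_simps)
    then have "U = 1/3" using M U3 by simp
    then have c3: "card T = 3" and u3: "\<And>x. x \<in> T \<Longrightarrow> u x = 1/3"
      using sum_squares_weights_ge(2)[OF T(1) u(2) cT, folded U_def] by blast+
    have "(\<Sum>x\<in>T. \<Sum>x'\<in>T. u x * u x' * (g x x' + mink x x')) = 0" unfolding diff \<open>U = 1/3\<close> eq by (simp add: field_simps)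
    then have "\<forall>x\<in>T. (\<Sum>x'\<in>T. u x * u x' * (g x x' + mink x x')) = 0"
      using T(1) nn by (subst (asm) sum_nonneg_eq_0_iff) (auto intro: sum_nonneg)
    then have "\<forall>x\<in>T. \<forall>x'\<in>T. u x * u x' * (g x x' + mink x x') = 0"
      using T(1) nn by (simp add: sum_nonneg_eq_0_iff)
    then have zero: "u x * u x' * (g x x' + mink x x') = 0" if "x \<in> T" "x' \<in> T" for x x' using that by blast
    have mM: "- mink x x' = M" if xx: "x \<in> T" "x' \<in> T" "x \<noteq> x'" for x x'
    proof -
      have "g x x' + mink x x' = 0" using zero[OF xx(1,2)] u3[OF xx(1)] u3[OF xx(2)] by simp
      then show ?thesis using xx(3) by (simp add: g_def)
    qed
    obtain x1 x2 x3 where x: "T = {x1, x2, x3}" "x1 \<noteq> x2" "x2 \<noteq> x3" "x1 \<noteq> x3" using c3 by (auto simp: card_3_iff)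
    have "T \<subseteq> hvec ` S" using T(2) by (auto simp: S'_def)
    then have "x1 \<in> hvec ` S" "x2 \<in> hvec ` S" "x3 \<in> hvec ` S" unfolding x(1) by simp_all
    then obtain v1 v2 v3 where v: "x1 = hvec v1" "x2 = hvec v2" "x3 = hvec v3" "v1 \<in> S" "v2 \<in> S" "v3 \<in> S"
      by (elim imageE)
    have "v1 \<noteq> v2" "v2 \<noteq> v3" "v1 \<noteq> v3" using x v by auto
    moreover have "cosh (dist v1 v2) = M" "cosh (dist v2 v3) = M" "cosh (dist v1 v3) = M"
      using mM[of x1 x2] mM[of x2 x3] mM[of x1 x3] x unfolding cosh_dist v by simp_all
    ultimately show ?thesis using v by blast
  qed
  have "S' \<noteq> {}" using yS' by auto
  then obtain v where "v \<in> S'" by auto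
  then have "mink y (hvec v) < 0" "mink y y < 0" using f1 by (auto simp: S'_def f_def)
  then have "y $ 3 > 0" using future_of_neg[of y v] by simp
  then obtain c k where ck: "k > 0" "hvec c = k *\<^sub>R y" using future_normalise \<open>mink y y < 0\<close> by blast
  have "k\<^sup>2 * f y = 1" using mink_hvec_self[of c] unfolding ck(2) by (simp add: f_def power2_eq_square)
  define r where "r = arcosh (sqrt (f y))"
  have r: "r \<ge> 0" "cosh r = sqrt (f y)" "(cosh r)\<^sup>2 = f y" using f1 by (auto simp: r_def)
  have "sqrt (f y) = k * f y"
    using \<open>k\<^sup>2 * f y = 1\<close> ck(1) f1 by (intro real_sqrt_unique) (auto simp: power_mult_distrib power2_eq_square algebra_simps)
  show ?thesis
  proof (rule that[OF r(1)])
    fix x assume "x \<in> S"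
    have "cosh (dist c x) = k * (- mink y (hvec x))" unfolding cosh_dist ck by simp
    also have "\<dots> \<le> k * f y" using opt[OF \<open>x \<in> S\<close>] ck(1) by (intro mult_left_mono) auto
    also have "\<dots> = cosh r" using r \<open>sqrt (f y) = k * f y\<close> by simp
    finally show "dist c x \<le> r" using cosh_real_nonneg_le_iff[of "dist c x" r] r(1) by simp
  qed (use le eqc r in auto)
qed

text \<open>The three values \<open>cosh (dist c v)\<close> add up to \<open>- mink (hvec c) u\<close> with \<open>u = hvec x + hvec y + hvec z\<close>, and
  \<open>u\<close> is \<open>sqrt (- mink u u) = sqrt (3 + 6 * M)\<close> times a point \<open>g\<close>, for which \<open>cosh (dist c g) \<ge> 1\<close>.\<close>
lemma equilateral_circumradius_ge:
  fixes x y z c :: hyp_plane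
  assumes "cosh (dist x y) = M" "cosh (dist y z) = M" "cosh (dist x z) = M"
    and "dist c x \<le> r" "dist c y \<le> r" "dist c z \<le> r"
  shows "(cosh r)\<^sup>2 \<ge> (1 + 2 * M) / 3"
proof -
  define u where "u = 1 *\<^sub>R hvec x + 1 *\<^sub>R hvec y + 1 *\<^sub>R hvec z"
  have uu: "mink u u = - (3 + 6 * M)"
    unfolding u_def using assms(1-3) by (simp add: mink_hvec dist_commute)
  have "mink u u < 0" "u $ 3 > 0" unfolding u_def by (rule nonneg_comb_future; simp)+
  then obtain g k where k: "k > 0" "hvec g = k *\<^sub>R u" using future_normalise by blast
  have r: "r \<ge> 0" using assms(4) zero_le_dist order_trans by blast
  have "1 \<le> cosh (dist c g)" by (rule cosh_real_ge_1)
  also have "\<dots> = k * (cosh (dist c x) + cosh (dist c y) + cosh (dist c z))"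
    unfolding cosh_dist k u_def by (simp add: algebra_simps)
  also have "\<dots> \<le> k * (cosh r + cosh r + cosh r)"
    using assms(4-6) k r by (intro mult_left_mono add_mono) (auto simp: cosh_real_nonneg_le_iff)
  finally have "1\<^sup>2 \<le> (3 * k * cosh r)\<^sup>2" by (intro power_mono) (auto simp: algebra_simps)
  then have 1: "1 \<le> 9 * k\<^sup>2 * (cosh r)\<^sup>2" by (simp add: power_mult_distrib)
  have k2: "k\<^sup>2 * (3 + 6 * M) = 1" using mink_hvec_self[of g] uu unfolding k by (simp add: power2_eq_square algebra_simps)
  have "k\<^sup>2 * (3 + 6 * M) \<le> k\<^sup>2 * (9 * (cosh r)\<^sup>2)" unfolding k2 using 1 by (simp add: algebra_simps)
  then have "3 + 6 * M \<le> 9 * (cosh r)\<^sup>2" using k(1) by (subst (asm) mult_le_cancel_left_pos) auto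
  then show ?thesis by simp
qed

section \<open>Polygons and their vertices\<close>

text \<open>A polygon is the hull of its vertices: a generating set with the least number of points
  consists of vertices only.\<close>
lemma hpolygon_subset:
  assumes "hpolygon P" "hvertices P \<subseteq> C" "hconvex C"
  shows "P \<subseteq> C"
proof -
  obtain S0 where "finite S0 \<and> P = hconvex hull S0" using assms(1) by (auto simp: hpolygon_def)
  from ex_has_least_nat[of "\<lambda>S. finite S \<and> P = hconvex hull S", OF this, of card]
  obtain S where S: "finite S" "P = hconvex hull S"
    "\<And>S'. finite S' \<Longrightarrow> P = hconvex hull S' \<Longrightarrow> card S \<le> card S'" by blast
  have "S \<subseteq> hvertices P"
  proof
    fix x assume x: "x \<in> S"
    have "x \<notin> hconvex hull (S - {x})"
    proof
      assume "x \<in> hconvex hull (S - {x})"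
      then have "hconvex hull (insert x (S - {x})) = hconvex hull (S - {x})" by (rule hull_redundant)
      then have "P = hconvex hull (S - {x})" using x S(2) by (simp add: insert_absorb)
      then have "card S \<le> card (S - {x})" using S by simp
      then show False using card_Diff1_less[OF S(1) x] by simp
    qed
    then show "x \<in> hvertices P" using S x by (auto simp: hvertices_def)
  qed
  then show ?thesis using assms(2,3) unfolding S(2) by (intro hull_minimal) auto
qed

lemma hvertices_subset: "hvertices P \<subseteq> P"
  by (auto simp: hvertices_def hull_inc)

text \<open>The indices \<open>a < b < c\<close> lie in a window of length \<open>n\<close>. After reduction modulo \<open>n\<close> they are still in
  cyclic order, and a cyclic rotation does not change the determinant.\<close>
lemma cyclic_orientation:
  fixes v :: "nat \<Rightarrow> hyp_plane"
  assumes n: "n > 0" and pos: "\<And>i j k. i < j \<Longrightarrow> j < k \<Longrightarrow> k < n \<Longrightarrow> tri (hvec (v i)) (hvec (v j)) (hvec (v k)) > 0"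
    and abc: "a < b" "b < c" "c < a + n"
  shows "tri (hvec (v (a mod n))) (hvec (v (b mod n))) (hvec (v (c mod n))) > 0"
proof -
  define q x y z where "q = a div n" and "x = a mod n" and "y = b - q * n" and "z = c - q * n"
  have a: "a = q * n + x" "x < n" using n by (simp_all add: q_def x_def)
  have bc: "b = q * n + y" "c = q * n + z" using abc a by (simp_all add: y_def z_def)
  have o: "x < y" "y < z" "z < x + n" using abc unfolding a bc by simp_all
  have m: "a mod n = x" "b mod n = y mod n" "c mod n = z mod n" using a(2) unfolding a(1) bc by simp_all
  have w: "t mod n = t - n" if "n \<le> t" "t < x + n" for t using that a(2) by (simp add: mod_if)
  consider "z < n" | "y < n" "n \<le> z" | "n \<le> y" by linarith
  then show ?thesis
  proof cases
    case 1
    then show ?thesis unfolding m using pos[of x y z] o by simp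
  next
    case 2
    then have "z mod n = z - n" using w o by simp
    then show ?thesis unfolding m using pos[of "z - n" x y] 2 o
      tri_rotate[of "hvec (v (z - n))" "hvec (v x)" "hvec (v y)"] by simp
  next
    case 3
    then have "z mod n = z - n" "y mod n = y - n" using w o by simp_all
    then show ?thesis unfolding m using pos[of "y - n" "z - n" x] 3 o a(2)
      tri_rotate[of "hvec (v x)" "hvec (v (y - n))" "hvec (v (z - n))"] by simp
  qed
qed

lemma ordinary_reduced_ngon_imp_reduced_polygon:
  assumes "ordinary_reduced_ngon n v P" "hmin_width P = w" "w > 0"
  obtains m where "n = 2 * m + 1" "reduced_polygon (\<lambda>k. v (k mod n)) m w"
proof -
  have n: "n \<ge> 3" "odd n" and ng: "ngon_with_vertices n v P"
    and red: "\<And>i. i < n \<Longrightarrow> let a = v ((i + (n - 1) div 2) mod n); b = v ((i + (n + 1) div 2) mod n) in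
        infdist (v i) (hseg a b) = hmin_width P \<and>
        (\<exists>l p. hline l \<and> a \<in> l \<and> b \<in> l \<and> horth_proj l (v i) p \<and> p \<in> hseg a b - {a, b})"
    using assms(1) by (auto simp: ordinary_reduced_ngon_def)
  obtain m where m: "n = 2 * m + 1" using n(2) oddE by blast
  have pos: "\<And>i j k. i < j \<Longrightarrow> j < k \<Longrightarrow> k < n \<Longrightarrow> tri (hvec (v i)) (hvec (v j)) (hvec (v k)) > 0"
    using ng by (auto simp: ngon_with_vertices_def pos_oriented_def tri_def)
  have "reduced_polygon (\<lambda>k. v (k mod n)) m w"
  proof
    show "m \<ge> 1" using n(1) m by simp
    show "w > 0" by fact
    show "v ((k + (2 * m + 1)) mod n) = v (k mod n)" for k by (simp only: m[symmetric] mod_add_self2)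
    show "tri (hvec (v (a mod n))) (hvec (v (b mod n))) (hvec (v (c mod n))) > 0"
      if "a < b" "b < c" "c < a + (2 * m + 1)" for a b c
      using cyclic_orientation[of n v a b c] pos that n(1) by (simp add: m)
    fix k
    define i where "i = k mod n"
    have i: "i < n" using n(1) by (simp add: i_def)
    have ab: "v ((i + (n - 1) div 2) mod n) = v ((k + m) mod n)" "v ((i + (n + 1) div 2) mod n) = v ((k + m + 1) mod n)"
    proof -
      have "(n - 1) div 2 = m" "(n + 1) div 2 = m + 1" by (simp_all add: m)
      then show "v ((i + (n - 1) div 2) mod n) = v ((k + m) mod n)" "v ((i + (n + 1) div 2) mod n) = v ((k + m + 1) mod n)"
        by (simp_all only: i_def mod_add_left_eq add.assoc)
    qed
    obtain l p where lp: "infdist (v i) (hseg (v ((k + m) mod n)) (v ((k + m + 1) mod n))) = w" "hline l"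
      "v ((k + m) mod n) \<in> l" "v ((k + m + 1) mod n) \<in> l" "horth_proj l (v i) p"
      "p \<in> hseg (v ((k + m) mod n)) (v ((k + m + 1) mod n)) - {v ((k + m) mod n), v ((k + m + 1) mod n)}"
      using red[OF i] assms(2) unfolding Let_def ab by blast
    have "dist (v i) p = w" using infdist_orth_proj[OF lp(2-5)] lp(1,6) by simp
    then show "\<exists>p. p \<in> hseg (v ((k + m) mod n)) (v ((k + m + 1) mod n)) - {v ((k + m) mod n), v ((k + m + 1) mod n)} \<and>
        dist (v (k mod n)) p = w \<and> (\<forall>z \<in> {v ((k + m) mod n), v ((k + m + 1) mod n)}.
          cosh (dist (v (k mod n)) z) = cosh (dist (v (k mod n)) p) * cosh (dist p z))"
      using lp(6) orth_proj_right_angle[OF lp(5)] lp(3,4) unfolding i_def[symmetric] by blast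
  qed
  then show ?thesis using that m by blast
qed

text \<open>The numbers are pairwise neighbours on a cycle of length \<open>2m + 1\<close>. In increasing order they are \<open>a\<close>,
  \<open>a + 1\<close>, \<open>a + 2\<close>, and the outer two can only be neighbours across the end of the cycle.\<close>
lemma pairwise_adjacent_mod:
  fixes p1 p2 p3 m :: nat
  assumes "p1 \<noteq> p2" "p2 \<noteq> p3" "p1 \<noteq> p3"
    and adj: "\<And>a b. a \<in> {p1, p2, p3} \<Longrightarrow> b \<in> {p1, p2, p3} \<Longrightarrow> a < b \<Longrightarrow> b = a + 1 \<or> b = a + 2 * m"
  shows "m = 1"
proof -
  have sorted: "m = 1" if "a < b" "b < c" "a \<in> {p1, p2, p3}" "b \<in> {p1, p2, p3}" "c \<in> {p1, p2, p3}" for a b c :: nat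
  proof -
    have "a < c" using that by simp
    then have "c = a + 2 * m" "b = a + 1" "c = b + 1 \<or> c = b + 2 * m"
      using adj[of a b] adj[of b c] adj[of a c] that by auto
    then show ?thesis using \<open>b < c\<close> by linarith
  qed
  consider "p1 < p2" "p2 < p3" | "p1 < p3" "p3 < p2" | "p2 < p1" "p1 < p3" | "p2 < p3" "p3 < p1" | "p3 < p1" "p1 < p2" | "p3 < p2" "p2 < p1"
    using assms(1-3) by linarith
  then show ?thesis by cases (rule sorted, assumption, assumption, simp, simp, simp)+
qed

section \<open>The regular triangle of given height\<close>

text \<open>Here \<open>c\<close> is the positive root of \<open>2 * c\<^sup>2 - K * c - 1\<close>; the other root is negative.\<close>
lemma triangle_side_root:
  fixes K :: real
  assumes "K > 1"
  defines "c \<equiv> (K + sqrt (K\<^sup>2 + 8)) / 4"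
  shows "c > 1" "\<And>x. x > 0 \<Longrightarrow> 2 * x\<^sup>2 - 1 \<le> K * x \<longleftrightarrow> x \<le> c" "\<And>x. x > 0 \<Longrightarrow> 2 * x\<^sup>2 - 1 = K * x \<longleftrightarrow> x = c"
proof -
  define s where "s = sqrt (K\<^sup>2 + 8)"
  have s: "s\<^sup>2 = K\<^sup>2 + 8" "s > 0" using zero_le_power2[of K] by (auto simp: s_def add_nonneg_pos)
  have "s > 3"
  proof (rule power2_less_imp_less)
    have "1 < K\<^sup>2" using assms(1) by (simp add: one_less_power)
    then show "3\<^sup>2 < s\<^sup>2" using s by simp
  qed (use s in simp)
  moreover have "s > K" using s assms(1) by (intro power2_less_imp_less[of K s]) auto
  moreover have c: "c = (K + s) / 4" by (simp add: c_def s_def)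
  ultimately show c1: "c > 1" using assms(1) by simp
  have cK: "2 * c > K" using c \<open>s > K\<close> by simp
  have "16 * (2 * c\<^sup>2 - 1) = 2 * (K + s)\<^sup>2 - 16" by (simp add: c power_divide)
  also have "\<dots> = 16 * (K * c)" using s by (simp add: c power2_sum power2_eq_square algebra_simps)
  finally have root: "2 * c\<^sup>2 - 1 = K * c" by simp
  have f: "2 * x\<^sup>2 - 1 - K * x = (x - c) * (2 * (x + c) - K)" for x
  proof -
    have "(x - c) * (2 * (x + c) - K) = 2 * x\<^sup>2 - K * x - (2 * c\<^sup>2 - K * c)" by (simp add: power2_eq_square algebra_simps)
    then show ?thesis using root by simp
  qed
  fix x :: real assume "x > 0"
  then have p: "2 * (x + c) - K > 0" using cK by simp
  have "2 * x\<^sup>2 - 1 \<le> K * x \<longleftrightarrow> (x - c) * (2 * (x + c) - K) \<le> 0"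
    unfolding f[symmetric] by auto
  also have "\<dots> \<longleftrightarrow> x \<le> c" using p by (simp add: mult_le_0_iff)
  finally show "2 * x\<^sup>2 - 1 \<le> K * x \<longleftrightarrow> x \<le> c" .
  have "2 * x\<^sup>2 - 1 = K * x \<longleftrightarrow> (x - c) * (2 * (x + c) - K) = 0"
    unfolding f[symmetric] by auto
  also have "\<dots> \<longleftrightarrow> x = c" using p by simp
  finally show "2 * x\<^sup>2 - 1 = K * x \<longleftrightarrow> x = c" .
qed

text \<open>With \<open>x = cosh (d/2)\<close> the conditions become \<open>2 * x\<^sup>2 - 1 \<le> K * x\<close> and the corresponding equation. So the
  regular triangle with a height of hyperbolic cosine \<open>K\<close> has the side \<open>a\<close> with \<open>cosh (a/2) = c\<close>.\<close>
lemma half_distance_condition: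
  fixes K d :: real
  assumes "K > 1"
  defines "c \<equiv> (K + sqrt (K\<^sup>2 + 8)) / 4"
  shows "cosh d \<le> K * cosh (d/2) \<longleftrightarrow> cosh d \<le> 2 * c\<^sup>2 - 1" "cosh d = K * cosh (d/2) \<longleftrightarrow> cosh d = 2 * c\<^sup>2 - 1"
proof -
  have d: "cosh d = 2 * (cosh (d/2))\<^sup>2 - 1" using cosh_double_cosh[of "d/2"] by simp
  have p: "cosh (d/2) > 0" by (simp add: cosh_real_pos)
  have c: "c > 0" using triangle_side_root(1)[OF assms(1)] by (simp add: c_def)
  show "cosh d \<le> K * cosh (d/2) \<longleftrightarrow> cosh d \<le> 2 * c\<^sup>2 - 1"
    using triangle_side_root(2)[OF assms(1) p] p c unfolding d c_def[symmetric] by (simp add: abs_le_square_iff[symmetric])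
  show "cosh d = K * cosh (d/2) \<longleftrightarrow> cosh d = 2 * c\<^sup>2 - 1"
    using triangle_side_root(3)[OF assms(1) p] p c unfolding d c_def[symmetric] by (simp add: power2_eq_iff_nonneg)
qed

text \<open>The form in which the bound appears in Jung's theorem, for \<open>M = cosh a = 2 * c\<^sup>2 - 1\<close>.\<close>
lemma circumradius_bound_cosh:
  fixes c :: real
  assumes "c > 1"
  defines "R \<equiv> arsinh (2 / sqrt 3 * sqrt (c\<^sup>2 - 1))"
  shows "R \<ge> 0" "(cosh R)\<^sup>2 = (1 + 2 * (2 * c\<^sup>2 - 1)) / 3"
proof -
  have c: "c\<^sup>2 - 1 > 0" using assms(1) by (simp add: one_less_power)
  have "sinh R = 2 / sqrt 3 * sqrt (c\<^sup>2 - 1)" by (simp add: R_def)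
  then have "(sinh R)\<^sup>2 = 4 / 3 * (c\<^sup>2 - 1)" "sinh R \<ge> 0" using c by (simp_all add: power_mult_distrib power_divide)
  then show "R \<ge> 0" "(cosh R)\<^sup>2 = (1 + 2 * (2 * c\<^sup>2 - 1)) / 3" by (simp_all add: cosh_square_eq)
qed

section \<open>The circumradius\<close>

theorem theorem1p2:
  fixes w :: real and P :: "hyp_plane set"
  assumes "w > 0"
    and "ordinary_reduced_polygon P"
    and "hmin_width P = w"
  shows "hcircumradius P \<le>
           arsinh (2 / sqrt 3 * sqrt (((cosh w + sqrt ((cosh w)\<^sup>2 + 8)) / 4)\<^sup>2 - 1)) \<and>
         (hcircumradius P =
           arsinh (2 / sqrt 3 * sqrt (((cosh w + sqrt ((cosh w)\<^sup>2 + 8)) / 4)\<^sup>2 - 1))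
          \<longleftrightarrow> regular_triangle P)"
proof -
  define c where "c = (cosh w + sqrt ((cosh w)\<^sup>2 + 8)) / 4"
  define M where "M = 2 * c\<^sup>2 - 1"
  define R where "R = arsinh (2 / sqrt 3 * sqrt (c\<^sup>2 - 1))"
  have K: "cosh w > 1" using assms(1) cosh_real_ge_1[of w] cosh_real_one_iff[of w] by (auto simp: less_le)
  have c: "c > 1" unfolding c_def by (rule triangle_side_root(1)[OF K])
  have M: "M > 1" using c by (simp add: M_def one_less_power)
  note cond = half_distance_condition[OF K, folded c_def, folded M_def]
  have R: "R \<ge> 0" "(cosh R)\<^sup>2 = (1 + 2 * M) / 3"
    using circumradius_bound_cosh[OF c] by (simp_all add: R_def M_def)
  have R_le: "r \<le> R \<longleftrightarrow> (cosh r)\<^sup>2 \<le> (1 + 2 * M) / 3" "R \<le> r \<longleftrightarrow> (1 + 2 * M) / 3 \<le> (cosh r)\<^sup>2" if "r \<ge> 0" for r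
    using cosh_real_nonneg_le_iff[OF that R(1)] cosh_real_nonneg_le_iff[OF R(1) that]
    unfolding R(2)[symmetric] by (simp_all add: cosh_real_nonneg power_mono_iff)
  obtain n v where ngon: "ordinary_reduced_ngon n v P" using assms(2) by (auto simp: ordinary_reduced_polygon_def)
  then obtain m where n: "n = 2 * m + 1" and "reduced_polygon (\<lambda>k. v (k mod n)) m w"
    using ordinary_reduced_ngon_imp_reduced_polygon assms by blast
  then interpret reduced_polygon "\<lambda>k. v (k mod n)" m w by simp
  have P: "hpolygon P" and bij: "bij_betw v {..<n} (hvertices P)"
    using ngon by (auto simp: ordinary_reduced_ngon_def ngon_with_vertices_def)
  have vert: "hvertices P = v ` {..<n}" and inj: "inj_on v {..<n}" using bij by (auto simp: bij_betw_def)
  have fin: "finite (hvertices P)" "hvertices P \<noteq> {}" unfolding vert using n by auto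
  have lt: "cosh (dist (v p) (v q)) \<le> M" "cosh (dist (v p) (v q)) = M \<Longrightarrow> q = p + 1 \<or> q = p + 2 * m"
    if pq: "p < q" "q < n" for p q
    using vertex_distance_bound[of p q] pq cond[of "dist (v p) (v q)"] n by auto
  have le: "cosh (dist x y) \<le> M" if xy: "x \<in> hvertices P" "y \<in> hvertices P" for x y
  proof -
    obtain p q where "p < n" "q < n" "x = v p" "y = v q" using xy unfolding vert by blast
    then show ?thesis using lt(1)[of p q] lt(1)[of q p] M by (cases p q rule: linorder_cases) (auto simp: dist_commute)
  qed
  define radii where "radii = {r. \<exists>z. P \<subseteq> cball z r}"
  have radii_nonneg: "r \<ge> 0" if r: "r \<in> radii" for r
  proof -
    obtain z x where "P \<subseteq> cball z r" "x \<in> P" using r fin(2) hvertices_subset[of P] by (auto simp: radii_def)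
    then have "dist z x \<le> r" by auto
    then show ?thesis using zero_le_dist order_trans by blast
  qed
  then have bdd: "bdd_below radii" by (intro bdd_belowI)
  obtain z r where z: "r \<ge> 0" "\<And>x. x \<in> hvertices P \<Longrightarrow> dist z x \<le> r" "(cosh r)\<^sup>2 \<le> (1 + 2 * M) / 3"
    "(cosh r)\<^sup>2 = (1 + 2 * M) / 3 \<Longrightarrow>
      \<exists>x\<in>hvertices P. \<exists>y\<in>hvertices P. \<exists>z\<in>hvertices P. x \<noteq> y \<and> y \<noteq> z \<and> x \<noteq> z \<and>
        cosh (dist x y) = M \<and> cosh (dist y z) = M \<and> cosh (dist x z) = M"
    using jung[OF fin M le] by metis
  have "P \<subseteq> cball z r" using z(2) by (intro hpolygon_subset[OF P _ hconvex_cball]) auto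
  then have rr: "r \<in> radii" by (auto simp: radii_def)
  then have circ: "hcircumradius P \<le> r" unfolding hcircumradius_def radii_def[symmetric] using bdd by (intro cInf_lower)
  have upper: "hcircumradius P \<le> R" using circ z(3) R_le(1)[OF z(1)] by linarith
  have "regular_triangle P" if "hcircumradius P = R"
  proof -
    have "(cosh r)\<^sup>2 = (1 + 2 * M) / 3" using circ that R_le(2)[OF z(1)] z(3) by simp
    from z(4)[OF this] obtain x1 x2 x3 where x: "x1 \<in> hvertices P" "x2 \<in> hvertices P" "x3 \<in> hvertices P"
      "x1 \<noteq> x2" "x2 \<noteq> x3" "x1 \<noteq> x3" "cosh (dist x1 x2) = M" "cosh (dist x2 x3) = M" "cosh (dist x1 x3) = M" by blast
    obtain p1 p2 p3 where p: "p1 < n" "p2 < n" "p3 < n" "x1 = v p1" "x2 = v p2" "x3 = v p3" using x(1-3) unfolding vert by blast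
    have ne: "p1 \<noteq> p2" "p2 \<noteq> p3" "p1 \<noteq> p3" using x(4-6) p by auto
    have all_M: "cosh (dist (v a) (v b)) = M" if "a \<in> {p1, p2, p3}" "b \<in> {p1, p2, p3}" "a < b" for a b
      using that x(7-9) unfolding p by (auto simp: dist_commute)
    have "m = 1" using lt(2) all_M p(1-3) by (intro pairwise_adjacent_mod[OF ne]) blast
    then have c3: "card (hvertices P) = 3" using bij_betw_same_card[OF bij] n by simp
    then have "hvertices P = {x1, x2, x3}"
      using x(1-6) fin(1) by (intro card_subset_eq[symmetric]) auto
    moreover have "dist x2 x1 = dist x1 x2" "dist x3 x2 = dist x2 x3" "dist x3 x1 = dist x1 x3" by (simp_all add: dist_commute)
    moreover have "dist x2 x3 = dist x1 x2" "dist x1 x3 = dist x1 x2" using x(7-9) by (simp_all flip: cosh_dist_eq_iff)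
    ultimately have "\<forall>x\<in>hvertices P. \<forall>y\<in>hvertices P. x \<noteq> y \<longrightarrow> dist x y = dist x1 x2" by auto
    then show ?thesis unfolding regular_triangle_def using P c3 by blast
  qed
  moreover have "hcircumradius P = R" if reg: "regular_triangle P"
  proof -
    obtain s where s: "\<And>x y. x \<in> hvertices P \<Longrightarrow> y \<in> hvertices P \<Longrightarrow> x \<noteq> y \<Longrightarrow> dist x y = s" and c3: "card (hvertices P) = 3"
      using reg by (auto simp: regular_triangle_def)
    have m1: "m = 1" "n = 3" using c3 bij_betw_same_card[OF bij] n by simp_all
    have vs: "v 0 \<in> hvertices P" "v 1 \<in> hvertices P" "v 2 \<in> hvertices P" unfolding vert m1 by auto
    have "v 0 \<noteq> v 1" "v 1 \<noteq> v 2" "v 0 \<noteq> v 2"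
      using inj_on_eq_iff[OF inj, of 0 1] inj_on_eq_iff[OF inj, of 1 2] inj_on_eq_iff[OF inj, of 0 2] by (simp_all add: m1)
    then have d: "dist (v 0) (v 1) = s" "dist (v 0) (v 2) = s" "dist (v 1) (v 2) = s" using s vs by auto
    have "cosh s = cosh w * cosh (s / 2)"
      using equilateral_side_half[of s] d m1 by simp
    then have sM: "cosh s = M" using cond(2)[of s] by simp
    have "R \<le> r'" if r': "r' \<in> radii" for r'
    proof -
      obtain z' where "P \<subseteq> cball z' r'" using r' by (auto simp: radii_def)
      then have "dist z' (v 0) \<le> r'" "dist z' (v 1) \<le> r'" "dist z' (v 2) \<le> r'" using vs hvertices_subset[of P] by auto
      then have "(1 + 2 * M) / 3 \<le> (cosh r')\<^sup>2"
        by (rule equilateral_circumradius_ge[of "v 0" "v 1" M "v 2" z' r', unfolded d, OF sM sM sM])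
      then show ?thesis using R_le(2) radii_nonneg[OF r'] by simp
    qed
    then have "R \<le> hcircumradius P" unfolding hcircumradius_def radii_def[symmetric] using rr by (intro cInf_greatest) auto
    then show ?thesis using upper by simp
  qed
  ultimately show ?thesis using upper unfolding R_def c_def by blast
qed

end
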